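(* Let $(M=\mathbb{R}\times M_0,\langle\cdot,\cdot\rangle)$ be a standard stationary spacetime, with $\langle\cdot,\cdot\rangle=-\beta(x)\,dt^2+\langle\cdot,\cdot\rangle_R+2\langle\delta,\cdot\rangle_R\,dt$, and let $V,W$ be vector fields on $M_0$. Put $\Lambda=-1/(\beta+\|\delta\|_R^2)$. Then: (i) $$\nabla_{\partial_t}\partial_t=-\tfrac12\Lambda\langle\delta,\nabla^R\beta\rangle_R\,\partial_t+\tfrac12\Lambda\langle\delta,\nabla^R\beta\rangle_R\,\delta+\tfrac12\nabla^R\beta .$$ (ii) $$\nabla_{\overline V}\overline W=\tfrac12\Lambda\big(\langle W,\nabla^R_V\delta\rangle_R+\langle V,\nabla^R_W\delta\rangle_R\big)\partial_t-\tfrac12\Lambda\big(\langle W,\nabla^R_V\delta\rangle_R+\langle V,\nabla^R_W\delta\rangle_R\big)\delta+\nabla^R_VW .$$ (iii) $$2\nabla_{\overline V}\partial_t=2\nabla_{\partial_t}\overline V=-\Lambda\big(V(\beta)+\langle\delta,\nabla^R_V\delta\rangle_R-\langle\nabla^R_\delta\delta,V\rangle_R\big)\partial_t+\Lambda\big(V(\beta)+\langle\delta,\nabla^R_V\delta\rangle_R-\langle\nabla^R_\delta\delta,V\rangle_R\big)\delta+\nabla^R_V\delta-\langle\nabla^R_{(\cdot)}\delta,V\rangle_R^{\natural}.$$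
   Context: A (standard) stationary spacetime is the product manifold $M=\mathbb{R}\times M_0$, where $(M_0,\langle\cdot,\cdot\rangle_R)$ is a Riemannian manifold, endowed with the Lorentz metric $\langle\cdot,\cdot\rangle=-\beta(x)\,dt^2+\langle\cdot,\cdot\rangle_R+2\langle\delta,\cdot\rangle_R\,dt$, where $\delta$ is a smooth vector field on $M_0$ and $\beta$ is a positive smooth function on $M_0$; that is, for $(\tau,v)\in T_t\mathbb{R}\times T_xM_0$ with $\tau\in\mathbb{R}$, $\langle(\tau,v),(\tau,v)\rangle=-\beta(x)\tau^2+\langle v,v\rangle_R+2\tau\langle\delta(x),v\rangle_R$. $\nabla$ and $\nabla^R$ denote the Levi-Civita connections of $\langle\cdot,\cdot\rangle$ and $\langle\cdot,\cdot\rangle_R$; $\nabla^R\beta$ is the $\langle\cdot,\cdot\rangle_R$-gradient of $\beta$; $\|\cdot\|_R$ is the $\langle\cdot,\cdot\rangle_R$-norm. For a vector field $V$ on $M_0$, $\overline V$ denotes its lift to $M$, $\overline V_{(t,x)}=V_x$. On the right-hand sides of the formulas, vector fields on $M_0$ (such as $\delta$, $\nabla^R\beta$, $\nabla^R_VW$) are identified with their lifts to $M$ and functions on $M_0$ with functions on $M$. The symbol $^{\natural}$ denotes the vector field on $M_0$ $\langle\cdot,\cdot\rangle_R$-metrically associated to a 1-form, so $\langle Y,\langle\nabla^R_{(\cdot)}\delta,V\rangle_R^{\natural}\rangle_R=\langle\nabla^R_Y\delta,V\rangle_R$ for every vector field $Y$ on $M_0$. *)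

theory Defs
  imports "HOL-Analysis.Analysis" "HOL-Library.Function_Algebras"
begin

section \<open>Smooth manifolds\<close>

text \<open>
  A manifold is a whole type, Hausdorff and second countable by its type class, together with
  an atlas: a set of pairs of a chart domain and a chart map into the model space. The atlas need
  not be maximal.
\<close>

type_synonym ('a, 'e) atlas = "('a set \<times> ('a \<Rightarrow> 'e)) set"

primrec Ck_on ::
  "nat \<Rightarrow> 'e::real_normed_vector set \<Rightarrow> ('e \<Rightarrow> 'b::real_normed_vector) \<Rightarrow> bool"
where
  "Ck_on 0 S f \<longleftrightarrow> continuous_on S f"
| "Ck_on (Suc k) S f \<longleftrightarrow>
     (\<forall>x\<in>S. f differentiable (at x)) \<and> (\<forall>v. Ck_on k S (\<lambda>x. frechet_derivative f (at x) v))"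

text \<open>Only meant for open \<open>S\<close>.\<close>

definition smooth_on ::
  "'e::real_normed_vector set \<Rightarrow> ('e \<Rightarrow> 'b::real_normed_vector) \<Rightarrow> bool"
where
  "smooth_on S f \<longleftrightarrow> (\<forall>k. Ck_on k S f)"

definition smooth_atlas ::
  "('a::{t2_space, second_countable_topology}, 'e::euclidean_space) atlas \<Rightarrow> bool"
where
  "smooth_atlas A \<longleftrightarrow>
     (\<Union>(U, \<phi>)\<in>A. U) = UNIV \<and>
     (\<forall>(U, \<phi>)\<in>A. open U \<and> open (\<phi> ` U) \<and> homeomorphism U (\<phi> ` U) \<phi> (inv_into U \<phi>)) \<and>
     (\<forall>(U, \<phi>)\<in>A. \<forall>(V, \<psi>)\<in>A. smooth_on (\<phi> ` (U \<inter> V)) (\<psi> \<circ> inv_into U \<phi>))"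

definition smooth_fun :: "('a, 'e::euclidean_space) atlas \<Rightarrow> ('a \<Rightarrow> real) \<Rightarrow> bool" where
  "smooth_fun A f \<longleftrightarrow> (\<forall>(U, \<phi>)\<in>A. smooth_on (\<phi> ` U) (f \<circ> inv_into U \<phi>))"

text \<open>
  A tangent vector at \<open>p\<close> is the operator \<open>\<Sum>\<^sub>i e\<^sub>i \<partial>\<^sub>i\<close> at \<open>p\<close> on smooth functions, in some chart
  around \<open>p\<close>. It is set to \<open>0\<close> on functions that are not smooth, so that equality of tangent
  vectors is equality of HOL functions. Sums of tangent vectors are pointwise sums.
\<close>

type_synonym 'a tvec = "('a \<Rightarrow> real) \<Rightarrow> real"

definition tangent_space :: "('a, 'e::euclidean_space) atlas \<Rightarrow> 'a \<Rightarrow> 'a tvec set" where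
  "tangent_space A p =
     {v. \<exists>(U, \<phi>)\<in>A. p \<in> U \<and>
           (\<exists>e. v = (\<lambda>f. if smooth_fun A f
                         then frechet_derivative (f \<circ> inv_into U \<phi>) (at (\<phi> p)) e else 0))}"

definition tscale :: "real \<Rightarrow> 'a tvec \<Rightarrow> 'a tvec"  (infixr \<open>*\<^sub>T\<close> 75) where
  "c *\<^sub>T v = (\<lambda>f. c * v f)"

type_synonym 'a vfield = "'a \<Rightarrow> 'a tvec"

definition vector_fields :: "('a, 'e::euclidean_space) atlas \<Rightarrow> 'a vfield set" where
  "vector_fields A =
     {X. (\<forall>p. X p \<in> tangent_space A p) \<and> (\<forall>f. smooth_fun A f \<longrightarrow> smooth_fun A (\<lambda>p. X p f))}"

definition lie_bracket :: "'a vfield \<Rightarrow> 'a vfield \<Rightarrow> 'a vfield" where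
  "lie_bracket X Y = (\<lambda>p f. X p (\<lambda>q. Y q f) - Y p (\<lambda>q. X q f))"


section \<open>Metrics and the Levi-Civita connection\<close>

type_synonym 'a metric = "'a \<Rightarrow> 'a tvec \<Rightarrow> 'a tvec \<Rightarrow> real"

definition riemannian_metric :: "('a, 'e::euclidean_space) atlas \<Rightarrow> 'a metric \<Rightarrow> bool" where
  "riemannian_metric A g \<longleftrightarrow>
     (\<forall>p. \<forall>u\<in>tangent_space A p. \<forall>v\<in>tangent_space A p. \<forall>w\<in>tangent_space A p. \<forall>c.
        g p (u + v) w = g p u w + g p v w \<and> g p (c *\<^sub>T u) w = c * g p u w) \<and>
     (\<forall>p. \<forall>u\<in>tangent_space A p. \<forall>v\<in>tangent_space A p. g p u v = g p v u) \<and>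
     (\<forall>p. \<forall>u\<in>tangent_space A p. u \<noteq> 0 \<longrightarrow> g p u u > 0) \<and>
     (\<forall>X\<in>vector_fields A. \<forall>Y\<in>vector_fields A. smooth_fun A (\<lambda>p. g p (X p) (Y p)))"

definition affine_connection ::
  "('a, 'e::euclidean_space) atlas \<Rightarrow> ('a vfield \<Rightarrow> 'a vfield \<Rightarrow> 'a vfield) \<Rightarrow> bool"
where
  "affine_connection A nabla \<longleftrightarrow>
     (\<forall>X\<in>vector_fields A. \<forall>Y\<in>vector_fields A. nabla X Y \<in> vector_fields A) \<and>
     (\<forall>X\<in>vector_fields A. \<forall>Y\<in>vector_fields A. \<forall>Z\<in>vector_fields A.
        nabla (X + Y) Z = nabla X Z + nabla Y Z \<and> nabla X (Y + Z) = nabla X Y + nabla X Z) \<and>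
     (\<forall>X\<in>vector_fields A. \<forall>Y\<in>vector_fields A. \<forall>f. smooth_fun A f \<longrightarrow>
        nabla (\<lambda>p. f p *\<^sub>T X p) Y = (\<lambda>p. f p *\<^sub>T nabla X Y p) \<and>
        nabla X (\<lambda>p. f p *\<^sub>T Y p) = (\<lambda>p. X p f *\<^sub>T Y p + f p *\<^sub>T nabla X Y p))"

text \<open>Values of \<open>nabla\<close> outside the smooth vector fields are left unconstrained.\<close>

definition levi_civita ::
  "('a, 'e::euclidean_space) atlas \<Rightarrow> 'a metric \<Rightarrow>
   ('a vfield \<Rightarrow> 'a vfield \<Rightarrow> 'a vfield) \<Rightarrow> bool"
where
  "levi_civita A g nabla \<longleftrightarrow>
     affine_connection A nabla \<and>
     (\<forall>X\<in>vector_fields A. \<forall>Y\<in>vector_fields A. nabla X Y - nabla Y X = lie_bracket X Y) \<and>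
     (\<forall>X\<in>vector_fields A. \<forall>Y\<in>vector_fields A. \<forall>Z\<in>vector_fields A. \<forall>p.
        X p (\<lambda>q. g q (Y q) (Z q)) = g p (nabla X Y p) (Z p) + g p (Y p) (nabla X Z p))"

text \<open>
  The vector field metrically associated to a 1-form, where the 1-form is given by its action on
  vector fields.
\<close>

definition sharp ::
  "('a, 'e::euclidean_space) atlas \<Rightarrow> 'a metric \<Rightarrow> ('a vfield \<Rightarrow> 'a \<Rightarrow> real) \<Rightarrow> 'a vfield"
where
  "sharp A g \<omega> =
     (\<lambda>p. THE v. v \<in> tangent_space A p \<and> (\<forall>Y\<in>vector_fields A. g p (Y p) v = \<omega> Y p))"

definition gradient ::
  "('a, 'e::euclidean_space) atlas \<Rightarrow> 'a metric \<Rightarrow> ('a \<Rightarrow> real) \<Rightarrow> 'a vfield"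
where
  "gradient A g f = sharp A g (\<lambda>Y p. Y p f)"


section \<open>Standard stationary spacetimes\<close>

definition spacetime_atlas ::
  "('a, 'e::euclidean_space) atlas \<Rightarrow> (real \<times> 'a, real \<times> 'e) atlas"
where
  "spacetime_atlas A = (\<lambda>(U, \<phi>). (UNIV \<times> U, \<lambda>(t, x). (t, \<phi> x))) ` A"

text \<open>
  The tangent vector of \<open>\<real> \<times> M\<^sub>0\<close> at \<open>(t, x)\<close> corresponding to \<open>(\<tau>, v)\<close>, where \<open>v\<close> is tangent to
  \<open>M\<^sub>0\<close> at \<open>x\<close>. The components of a tangent vector are recovered by the differentials \<open>d_time\<close>
  and \<open>d_space\<close> of the two projections.
\<close>

definition tvec_pair ::
  "('a, 'e::euclidean_space) atlas \<Rightarrow> real \<times> 'a \<Rightarrow> real \<Rightarrow> 'a tvec \<Rightarrow> (real \<times> 'a) tvec"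
where
  "tvec_pair A p \<tau> v =
     (\<lambda>f. if smooth_fun (spacetime_atlas A) f
          then \<tau> * deriv (\<lambda>s. f (s, snd p)) (fst p) + v (\<lambda>y. f (fst p, y)) else 0)"

definition d_time :: "(real \<times> 'a) tvec \<Rightarrow> real" where
  "d_time u = u fst"

definition d_space :: "(real \<times> 'a) tvec \<Rightarrow> 'a tvec" where
  "d_space u = (\<lambda>h. u (h \<circ> snd))"

definition stationary_metric ::
  "'a metric \<Rightarrow> ('a \<Rightarrow> real) \<Rightarrow> 'a vfield \<Rightarrow> (real \<times> 'a) metric"
where
  "stationary_metric gR \<beta> \<delta> = (\<lambda>(t, x) u w.
     - \<beta> x * d_time u * d_time w + gR x (d_space u) (d_space w)
     + gR x (\<delta> x) (d_space u) * d_time w + gR x (\<delta> x) (d_space w) * d_time u)"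

definition time_field :: "('a, 'e::euclidean_space) atlas \<Rightarrow> (real \<times> 'a) vfield" where
  "time_field A = (\<lambda>p. tvec_pair A p 1 0)"

definition lift :: "('a, 'e::euclidean_space) atlas \<Rightarrow> 'a vfield \<Rightarrow> (real \<times> 'a) vfield" where
  "lift A V = (\<lambda>p. tvec_pair A p 0 (V (snd p)))"

end

theory Submission
  imports Defs "HOL-Real_Asymp.Real_Asymp"
begin

text \<open>
  Time translations are isometries and \<open>\<partial>\<^sub>t\<close> commutes with lifted fields, so the Koszul formula
  expresses the products of each covariant derivative with \<open>\<partial>\<^sub>t\<close> and with the lifts through
  \<open>\<beta>\<close>, \<open>\<delta>\<close> and the connection of \<open>M\<^sub>0\<close>. A tangent vector \<open>(\<tau>, v)\<close> is determined by these products: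
  those with lifts give \<open>v + \<tau> \<delta>\<close>, the one with \<open>\<partial>\<^sub>t\<close> then gives \<open>- \<tau> (\<beta> + \<parallel>\<delta>\<parallel>\<^sup>2)\<close>, hence the factor \<open>\<Lambda>\<close>.

  Vector fields act on global functions only. Bump functions are what makes their chart
  components smooth (so that lifts are smooth) and what extends a tangent vector to a vector field.
\<close>

section \<open>Functions of class \<open>C\<^sup>k\<close>\<close>

text \<open>The field \<open>time_field A - lift A \<delta>\<close> is orthogonal to every lift,
  hence normal to the slices t = const, and its square in the stationary metric is -(\<beta> +
  |\<delta>|^2) = 1/\<Lambda>. Each formula splits a covariant derivative into a part tangent to the
  slices and a multiple of this normal; this is why \<open>time_field A\<close> and
  \<open>lift A \<delta>\<close> always carry opposite coefficients, both with the factor \<Lambda>.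
  Two points need analysis. That the time field commutes with lifts is the symmetry of second
  derivatives in a product chart. That a lift is smooth is not immediate: for f on the product,
  smoothness of V on functions of x alone only gives smoothness of V (f(t, .)) in x for each t
  separately, and joint smoothness in (t, x) comes from smooth chart components of V.\<close>

lemma frechet_derivative_eqI:
  "(f has_derivative f') (at x) \<Longrightarrow> frechet_derivative f (at x) = f'"
  by (simp add: frechet_derivative_at[symmetric])

lemma frechet_derivative_cong_open:
  assumes "open S" "x \<in> S" "\<And>y. y \<in> S \<Longrightarrow> f y = g y"
  shows "frechet_derivative f (at x) = frechet_derivative g (at x)"
proof -
  have "(f has_derivative D) (at x) \<longleftrightarrow> (g has_derivative D) (at x)" for D
    using assms has_derivative_transform_within_open[of f D x UNIV S g]
      has_derivative_transform_within_open[of g D x UNIV S f] by auto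
  then show ?thesis by (simp add: frechet_derivative_def)
qed

lemma differentiable_cong_open:
  assumes "open S" "x \<in> S" "\<And>y. y \<in> S \<Longrightarrow> f y = g y" "f differentiable (at x)"
  shows "g differentiable (at x)"
  using assms has_derivative_transform_within_open[of f _ x UNIV S g]
  unfolding differentiable_def by blast

text \<open>A formula for the derivative is available on S only, while \<open>Ck_on\<close> speaks
  of \<open>frechet_derivative\<close> as a function on the whole type. Every closure proof below
  bridges this gap here; openness of S makes the derivative depend on values in S alone.\<close>

lemma Ck_on_cong:
  assumes "open S" "\<And>y. y \<in> S \<Longrightarrow> f y = g y" "Ck_on k S f"
  shows "Ck_on k S g"
  using assms(2,3)
proof (induction k arbitrary: f g)
  case 0
  then show ?case by (metis Ck_on.simps(1) continuous_on_cong)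
next
  case (Suc k)
  have "Ck_on k S (\<lambda>x. frechet_derivative g (at x) v)" for v
  proof (rule Suc.IH)
    show "Ck_on k S (\<lambda>x. frechet_derivative f (at x) v)" using Suc.prems(2) by simp
    show "frechet_derivative f (at y) v = frechet_derivative g (at y) v" if "y \<in> S" for y
      using frechet_derivative_cong_open[OF assms(1) that Suc.prems(1)] by simp
  qed
  moreover have "\<forall>x\<in>S. g differentiable (at x)"
    using Suc.prems differentiable_cong_open[OF assms(1), of _ f g] by auto
  ultimately show ?case by simp
qed

lemma Ck_on_subset: "Ck_on k S f \<Longrightarrow> T \<subseteq> S \<Longrightarrow> Ck_on k T f"
  by (induction k arbitrary: f) (auto intro: continuous_on_subset)

text \<open>Allows a different description of the function near each point, as needed for functions
  extended by zero and for lifted fields, whose components are known only locally.\<close>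

lemma Ck_on_local:
  assumes "\<And>x. x \<in> S \<Longrightarrow> \<exists>T. open T \<and> x \<in> T \<and> Ck_on k T f"
  shows "Ck_on k S f"
  using assms
proof (induction k arbitrary: f)
  case 0
  have "isCont f x" if "x \<in> S" for x
    using 0[OF that] continuous_on_eq_continuous_at by auto
  then show ?case by (simp add: continuous_at_imp_continuous_on)
next
  case (Suc k)
  have "f differentiable (at x)" if "x \<in> S" for x
    using Suc.prems[OF that] by auto
  moreover have "Ck_on k S (\<lambda>x. frechet_derivative f (at x) v)" for v
    by (rule Suc.IH) (use Suc.prems in fastforce)
  ultimately show ?case by simp
qed

text \<open>The recursion for class k+1 mentions derivatives only, not class k of the function
  itself. The claim descends through the derivatives until differentiability yields
  continuity.\<close>

lemma Ck_on_SucD: "Ck_on (Suc k) S f \<Longrightarrow> Ck_on k S f"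
proof (induction k arbitrary: f)
  case 0
  then show ?case
    by (auto intro!: continuous_at_imp_continuous_on differentiable_imp_continuous_within)
next
  case (Suc k)
  then show ?case by (metis Ck_on.simps(2))
qed

lemma Ck_on_const: "Ck_on k S (\<lambda>x. c)"
  by (induction k arbitrary: c) auto

lemma Ck_on_bounded_linear:
  assumes "bounded_linear L" shows "Ck_on k S L"
proof (cases k)
  case 0
  then show ?thesis using assms by (simp add: linear_continuous_on)
next
  case (Suc j)
  have D: "(L has_derivative L) (at x)" for x
    by (rule bounded_linear_imp_has_derivative[OF assms])
  then show ?thesis
    using Suc by (auto simp: frechet_derivative_eqI[OF D] Ck_on_const intro: differentiableI)
qed

lemma Ck_on_add:
  assumes "open S" "Ck_on k S f" "Ck_on k S g"
  shows "Ck_on k S (\<lambda>x. f x + g x)"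
  using assms(2,3)
proof (induction k arbitrary: f g)
  case 0
  then show ?case by (auto intro: continuous_on_add)
next
  case (Suc k)
  have "Ck_on k S (\<lambda>x. frechet_derivative (\<lambda>x. f x + g x) (at x) v)" for v
  proof (rule Ck_on_cong[OF assms(1)])
    show "Ck_on k S (\<lambda>x. frechet_derivative f (at x) v + frechet_derivative g (at x) v)"
      using Suc by simp
    show "frechet_derivative f (at x) v + frechet_derivative g (at x) v
        = frechet_derivative (\<lambda>x. f x + g x) (at x) v" if "x \<in> S" for x
      using that Suc.prems
      by (subst frechet_derivative_eqI[OF has_derivative_add])
         (auto simp: frechet_derivative_works[symmetric])
  qed
  with Suc.prems show ?case by auto
qed

lemma Ck_on_scaleR:
  fixes f :: "'a::real_normed_vector \<Rightarrow> real" and g :: "'a \<Rightarrow> 'b::real_normed_vector"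
  assumes "open S" "Ck_on k S f" "Ck_on k S g"
  shows "Ck_on k S (\<lambda>x. f x *\<^sub>R g x)"
  using assms(2,3)
proof (induction k arbitrary: f g)
  case 0
  then show ?case by (auto intro: continuous_on_scaleR)
next
  case (Suc k)
  have "Ck_on k S (\<lambda>x. frechet_derivative (\<lambda>x. f x *\<^sub>R g x) (at x) v)" for v
  proof (rule Ck_on_cong[OF assms(1)])
    show "Ck_on k S (\<lambda>x. f x *\<^sub>R frechet_derivative g (at x) v + frechet_derivative f (at x) v *\<^sub>R g x)"
      using Suc Ck_on_SucD[OF Suc.prems(1)] Ck_on_SucD[OF Suc.prems(2)]
      by (intro Ck_on_add[OF assms(1)] Suc.IH) auto
    show "f x *\<^sub>R frechet_derivative g (at x) v + frechet_derivative f (at x) v *\<^sub>R g x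
        = frechet_derivative (\<lambda>x. f x *\<^sub>R g x) (at x) v" if "x \<in> S" for x
      using that Suc.prems
      by (subst frechet_derivative_eqI[OF has_derivative_scaleR])
         (auto simp: frechet_derivative_works[symmetric])
  qed
  with Suc.prems show ?case by auto
qed

lemma Ck_on_mult:
  fixes f g :: "'a::real_normed_vector \<Rightarrow> real"
  assumes "open S" "Ck_on k S f" "Ck_on k S g"
  shows "Ck_on k S (\<lambda>x. f x * g x)"
  using Ck_on_scaleR[OF assms] by simp

lemma Ck_on_minus:
  assumes "open S" "Ck_on k S f"
  shows "Ck_on k S (\<lambda>x. - f x)"
  using Ck_on_scaleR[OF assms(1) Ck_on_const[of k S "-1"] assms(2)] by simp

lemma Ck_on_diff:
  assumes "open S" "Ck_on k S f" "Ck_on k S g"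
  shows "Ck_on k S (\<lambda>x. f x - g x)"
  using Ck_on_add[OF assms(1,2) Ck_on_minus[OF assms(1,3)]] by simp

lemma Ck_on_sum:
  assumes "open S" "\<And>i. i \<in> I \<Longrightarrow> Ck_on k S (f i)"
  shows "Ck_on k S (\<lambda>x. \<Sum>i\<in>I. f i x)"
  using assms(2)
  by (induction I rule: infinite_finite_induct) (auto intro: Ck_on_const Ck_on_add[OF assms(1)])

lemma Ck_on_bounded_linear_image:
  assumes "open S" "bounded_linear L" "Ck_on k S f"
  shows "Ck_on k S (\<lambda>x. L (f x))"
  using assms(3)
proof (induction k arbitrary: f)
  case 0
  then show ?case using bounded_linear.continuous_on[OF assms(2)] by auto
next
  case (Suc k)
  have D: "((\<lambda>x. L (f x)) has_derivative (\<lambda>v. L (frechet_derivative f (at x) v))) (at x)"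
    if "x \<in> S" for x
    using that Suc.prems
    by (intro bounded_linear.has_derivative[OF assms(2)])
       (auto simp: frechet_derivative_works[symmetric])
  have "Ck_on k S (\<lambda>x. frechet_derivative (\<lambda>x. L (f x)) (at x) v)" for v
  proof (rule Ck_on_cong[OF assms(1)])
    show "Ck_on k S (\<lambda>x. L (frechet_derivative f (at x) v))" using Suc by simp
  qed (simp add: frechet_derivative_eqI[OF D])
  then show ?case using D by (auto intro: differentiableI)
qed

lemma linear_euclidean_sum:
  fixes f :: "'a::euclidean_space \<Rightarrow> 'b::real_vector"
  assumes "linear f"
  shows "f w = (\<Sum>b\<in>Basis. (w \<bullet> b) *\<^sub>R f b)"
proof -
  have "f w = f (\<Sum>b\<in>Basis. (w \<bullet> b) *\<^sub>R b)" by (simp add: euclidean_representation)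
  also have "\<dots> = (\<Sum>b\<in>Basis. (w \<bullet> b) *\<^sub>R f b)"
    using assms by (simp add: linear_sum linear_cmul)
  finally show ?thesis .
qed

lemma frechet_derivative_compose_at:
  assumes "g differentiable (at x)" "f differentiable (at (g x))"
  shows "frechet_derivative (\<lambda>x. f (g x)) (at x) v
    = frechet_derivative f (at (g x)) (frechet_derivative g (at x) v)"
  using frechet_derivative_compose[of g x f] assms by (simp add: o_def)

text \<open>The chain rule applies the derivative of f to a vector that varies with x, whereas
  \<open>Ck_on\<close> controls derivatives in fixed directions. Expanding that vector in the basis
  of the middle space gives a sum of products with factors of class k. The inner map stays fixed
  during the induction; only f is replaced by its derivatives.\<close>

lemma Ck_on_compose:
  fixes g :: "'d::real_normed_vector \<Rightarrow> 'e::euclidean_space" and f :: "'e \<Rightarrow> 'b::real_normed_vector"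
  assumes "open S" "\<And>x. x \<in> S \<Longrightarrow> g x \<in> T" "Ck_on k T f" "Ck_on k S g"
  shows "Ck_on k S (\<lambda>x. f (g x))"
  using assms(3,4)
proof (induction k arbitrary: f)
  case 0
  then show ?case
    using assms(2) continuous_on_compose2[of T f S g] by auto
next
  case (Suc k)
  let ?Df = "\<lambda>x. frechet_derivative f (at (g x))" and ?Dg = "\<lambda>x. frechet_derivative g (at x)"
  have diff: "g differentiable (at x)" "f differentiable (at (g x))" if "x \<in> S" for x
    using Suc.prems assms(2) that by auto
  have "Ck_on k S (\<lambda>x. frechet_derivative (\<lambda>x. f (g x)) (at x) v)" for v
  proof (rule Ck_on_cong[OF assms(1)])
    have "Ck_on k S (\<lambda>x. ?Df x b)" for b
      using Suc by (intro Suc.IH) (auto intro: Ck_on_SucD)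
    moreover have "Ck_on k S (\<lambda>x. ?Dg x v \<bullet> b)" for b
      using Suc.prems(2)
      by (intro Ck_on_bounded_linear_image[OF assms(1) bounded_linear_inner_left]) simp
    ultimately show "Ck_on k S (\<lambda>x. \<Sum>b\<in>Basis. (?Dg x v \<bullet> b) *\<^sub>R ?Df x b)"
      by (intro Ck_on_sum[OF assms(1)] Ck_on_scaleR[OF assms(1)])
    show "(\<Sum>b\<in>Basis. (?Dg x v \<bullet> b) *\<^sub>R ?Df x b) = frechet_derivative (\<lambda>x. f (g x)) (at x) v"
      if "x \<in> S" for x
      using diff[OF that] linear_euclidean_sum[OF linear_frechet_derivative]
      by (metis frechet_derivative_compose_at)
  qed
  moreover have "(\<lambda>x. f (g x)) differentiable (at x)" if "x \<in> S" for x
    using differentiable_chain_at[OF diff[OF that]] by (simp add: o_def)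
  ultimately show ?case by simp
qed


section \<open>Reciprocals and the flat function exp(-1/x)\<close>

lemma Ck_on_inverse: "Ck_on k {0<..} (inverse :: real \<Rightarrow> real)"
proof (induction k)
  case 0
  then show ?case by (auto intro!: continuous_intros)
next
  case (Suc k)
  have D: "(inverse has_derivative (\<lambda>v. - (inverse x * v * inverse x))) (at x)" if "x \<in> {0<..}" for x :: real
    by (rule has_derivative_inverse') (use that in auto)
  have "Ck_on k {0<..} (\<lambda>x. frechet_derivative inverse (at x) v)" for v :: real
  proof (rule Ck_on_cong[OF open_greaterThan])
    show "Ck_on k {0<..} (\<lambda>x::real. - (inverse x * v * inverse x))"
      by (intro Ck_on_minus Ck_on_mult Suc Ck_on_const) auto
  qed (simp only: frechet_derivative_eqI[OF D])
  then show ?case using D by (auto intro: differentiableI)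
qed

text \<open>The case n = 0 is the classical smooth function that is flat at 0. The extra power of
  1/x makes the linear span of the family closed under differentiation, so that one induction
  handles all derivatives.\<close>

definition flat_exp :: "nat \<Rightarrow> real \<Rightarrow> real" where
  "flat_exp n x = (if x > 0 then exp (- inverse x) * inverse x ^ n else 0)"

lemma flat_exp_tendsto_0: "(flat_exp n \<longlongrightarrow> 0) (at 0)"
proof -
  have "((\<lambda>x::real. exp (- inverse x) * inverse x ^ n) \<longlongrightarrow> 0) (at_right 0)"
    by real_asymp
  then have "(flat_exp n \<longlongrightarrow> 0) (at_right 0)"
    by (rule Lim_transform_eventually)
       (auto simp: flat_exp_def eventually_at_filter)
  moreover have "(flat_exp n \<longlongrightarrow> 0) (at_left 0)"
    by (rule tendsto_eventually) (auto simp: flat_exp_def eventually_at_filter)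
  ultimately show ?thesis by (simp add: filterlim_split_at)
qed

lemma flat_exp_has_derivative:
  "(flat_exp n has_real_derivative flat_exp (n + 2) x - n * flat_exp (n + 1) x) (at x)"
proof -
  consider "x > 0" | "x < 0" | "x = 0" by linarith
  then show ?thesis
  proof cases
    case 1
    have "((\<lambda>x. exp (- inverse x) * inverse x ^ n) has_real_derivative
        flat_exp (n + 2) x - n * flat_exp (n + 1) x) (at x)"
      using 1
      by (cases n)
         (auto intro!: derivative_eq_intros simp: flat_exp_def field_simps power2_eq_square,
          metis One_nat_def power_eq_if)
    then show ?thesis
      by (rule has_field_derivative_transform_within_open[where S = "{0<..}"])
         (use 1 in \<open>auto simp: flat_exp_def\<close>)
  next
    case 2
    have "((\<lambda>x. 0 :: real) has_real_derivative flat_exp (n + 2) x - n * flat_exp (n + 1) x) (at x)"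
      using 2 by (auto simp: flat_exp_def)
    then show ?thesis
      by (rule has_field_derivative_transform_within_open[where S = "{..<0}"])
         (use 2 in \<open>auto simp: flat_exp_def\<close>)
  next
    case 3
    \<comment> \<open>For nonzero h the difference quotient at 0 is
      \<open>flat_exp (n + 1) h\<close>, so flatness of the next member of the family gives the
      derivative 0.\<close>
    have "((\<lambda>h. (flat_exp n (0 + h) - flat_exp n 0) / h) \<longlongrightarrow> 0) (at 0)"
      by (rule Lim_transform_eventually[OF flat_exp_tendsto_0[of "n + 1"]])
         (auto simp: flat_exp_def eventually_at_filter field_simps)
    then show ?thesis using 3 by (simp add: DERIV_def flat_exp_def)
  qed
qed

lemma Ck_on_flat_exp: "Ck_on k UNIV (flat_exp n)"
proof (induction k arbitrary: n)
  case 0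
  then show ?case
    by (auto intro!: continuous_at_imp_continuous_on DERIV_isCont flat_exp_has_derivative)
next
  case (Suc k)
  have D: "(flat_exp n has_derivative (\<lambda>v. (flat_exp (n + 2) x - n * flat_exp (n + 1) x) * v)) (at x)" for x
    using flat_exp_has_derivative by (simp add: has_field_derivative_def)
  have "Ck_on k UNIV (\<lambda>x. frechet_derivative (flat_exp n) (at x) v)" for v
    unfolding frechet_derivative_eqI[OF D]
    by (intro Ck_on_mult Ck_on_diff Ck_on_const Suc) auto
  then show ?case using D by (auto intro: differentiableI)
qed

text \<open>Both orders of differentiation compute the same second difference over small parallelograms.\<close>

lemma second_difference_mvt:
  fixes F :: "'a::real_normed_vector \<Rightarrow> real"
  defines "D \<equiv> \<lambda>w y. frechet_derivative F (at y) w"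
  assumes "Ck_on 2 S F" "s > 0"
    and S: "\<And>a b. \<lbrakk>0 \<le> a; a \<le> s; 0 \<le> b; b \<le> s\<rbrakk> \<Longrightarrow> x + a *\<^sub>R u + b *\<^sub>R v \<in> S"
  shows "\<exists>a b. 0 < a \<and> a < s \<and> 0 < b \<and> b < s \<and>
    F (x + s *\<^sub>R u + s *\<^sub>R v) - F (x + s *\<^sub>R u) - F (x + s *\<^sub>R v) + F x
      = s * (s * frechet_derivative (D u) (at (x + a *\<^sub>R u + b *\<^sub>R v)) v)"
proof -
  have dF: "F differentiable (at y)" and dD: "D w differentiable (at y)" if "y \<in> S" for y w
    using assms(2) that by (auto simp: numeral_2_eq_2 D_def)
  \<comment> \<open>The second difference is the increment of \<open>?g\<close> from 0 to s. A mean
    value step along u leaves an increment of \<open>D u\<close> along v, to which a second mean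
    value step applies.\<close>
  let ?g = "\<lambda>a. F (x + a *\<^sub>R u + s *\<^sub>R v) - F (x + a *\<^sub>R u)"
  have line: "((\<lambda>a. H (c + a *\<^sub>R w)) has_real_derivative frechet_derivative H (at (c + a *\<^sub>R w)) w) (at a)"
    if "H differentiable (at (c + a *\<^sub>R w))" for H :: "'a \<Rightarrow> real" and c w a
  proof -
    have "((\<lambda>a. H (c + a *\<^sub>R w)) has_derivative (\<lambda>t. frechet_derivative H (at (c + a *\<^sub>R w)) (t *\<^sub>R w))) (at a)"
      by (rule has_derivative_compose[of "\<lambda>a. c + a *\<^sub>R w"])
         (use that in \<open>auto intro!: derivative_eq_intros simp: frechet_derivative_works[symmetric]\<close>)
    then show ?thesis
      using linear_cmul[OF linear_frechet_derivative[OF that]]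
      by (simp add: has_field_derivative_def mult_commute_abs)
  qed
  have "\<exists>a. 0 < a \<and> a < s \<and> ?g s - ?g 0 = (s - 0) * (D u (x + a *\<^sub>R u + s *\<^sub>R v) - D u (x + a *\<^sub>R u))"
  proof (rule MVT2[OF \<open>s > 0\<close>])
    fix a assume a: "0 \<le> a" "a \<le> s"
    have "((\<lambda>a. F ((x + s *\<^sub>R v) + a *\<^sub>R u)) has_real_derivative
        frechet_derivative F (at ((x + s *\<^sub>R v) + a *\<^sub>R u)) u) (at a)"
      using S[of a s] a \<open>s > 0\<close> by (intro line dF) (simp add: algebra_simps)
    moreover have "((\<lambda>a. F (x + a *\<^sub>R u)) has_real_derivative frechet_derivative F (at (x + a *\<^sub>R u)) u) (at a)"
      using S[of a 0] a \<open>s > 0\<close> by (intro line dF) simp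
    ultimately show "(?g has_real_derivative D u (x + a *\<^sub>R u + s *\<^sub>R v) - D u (x + a *\<^sub>R u)) (at a)"
      unfolding D_def by (intro DERIV_diff) (simp_all add: algebra_simps)
  qed
  then obtain a where a: "0 < a" "a < s"
    and ga: "?g s - ?g 0 = s * (D u (x + a *\<^sub>R u + s *\<^sub>R v) - D u (x + a *\<^sub>R u))" by auto
  have "\<exists>b. 0 < b \<and> b < s \<and> D u (x + a *\<^sub>R u + s *\<^sub>R v) - D u (x + a *\<^sub>R u + 0 *\<^sub>R v)
      = (s - 0) * frechet_derivative (D u) (at (x + a *\<^sub>R u + b *\<^sub>R v)) v"
    by (rule MVT2[OF \<open>s > 0\<close>]) (use a S in \<open>auto intro!: line dD\<close>)
  then obtain b where "0 < b" "b < s"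
    and "D u (x + a *\<^sub>R u + s *\<^sub>R v) - D u (x + a *\<^sub>R u)
      = s * frechet_derivative (D u) (at (x + a *\<^sub>R u + b *\<^sub>R v)) v" by auto
  with a ga show ?thesis by (intro exI[of _ a] exI[of _ b]) auto
qed

text \<open>If the two values at x differed, continuity would keep the two mixed derivatives apart
  near x, although the common second difference forces them to agree at a pair of points of a small
  parallelogram. In a product chart this yields the commutation of the time field with
  lifts.\<close>

lemma frechet_derivative_symmetric:
  fixes F :: "'a::real_normed_vector \<Rightarrow> real"
  assumes "open S" "x \<in> S" "Ck_on 2 S F"
  shows "frechet_derivative (\<lambda>y. frechet_derivative F (at y) u) (at x) v
    = frechet_derivative (\<lambda>y. frechet_derivative F (at y) v) (at x) u" (is "?P u v x = ?P v u x")
proof (rule ccontr)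
  assume ne: "?P u v x \<noteq> ?P v u x"
  \<comment> \<open>Half the gap: one number cannot lie strictly within \<open>e\<close> of both
    values.\<close>
  define e where "e = \<bar>?P u v x - ?P v u x\<bar> / 2"
  have e: "e > 0" using ne by (simp add: e_def)
  have cont: "isCont (?P u' v') x" for u' v'
    using assms by (auto simp: numeral_2_eq_2 continuous_on_eq_continuous_at)
  obtain d1 where d1: "d1 > 0" "\<And>y. dist y x < d1 \<Longrightarrow> dist (?P u v y) (?P u v x) < e"
    using cont[of u v] e unfolding continuous_at_eps_delta by (metis (no_types, lifting))
  obtain d2 where d2: "d2 > 0" "\<And>y. dist y x < d2 \<Longrightarrow> dist (?P v u y) (?P v u x) < e"
    using cont[of v u] e unfolding continuous_at_eps_delta by (metis (no_types, lifting))
  obtain d3 where d3: "d3 > 0" "ball x d3 \<subseteq> S"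
    using assms(1,2) openE by blast
  define d where "d = min d1 (min d2 d3)"
  \<comment> \<open>The parallelogram with sides s u and s v then stays within d/2 of x; the summand
    1 keeps the denominator positive when u and v are both 0.\<close>
  define s where "s = d / (2 * (norm u + norm v + 1))"
  have d: "d > 0" using d1 d2 d3 by (simp add: d_def)
  have pos: "norm u + norm v + 1 > 0" by (smt (verit) norm_ge_zero)
  have s: "s > 0" using d pos by (simp add: s_def)
  have near: "dist (x + a *\<^sub>R u + b *\<^sub>R v) x < d" if "0 \<le> a" "a \<le> s" "0 \<le> b" "b \<le> s" for a b
  proof -
    have "dist (x + a *\<^sub>R u + b *\<^sub>R v) x = norm (a *\<^sub>R u + b *\<^sub>R v)" by (simp add: dist_norm)
    also have "\<dots> \<le> a * norm u + b * norm v"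
      using norm_triangle_ineq[of "a *\<^sub>R u" "b *\<^sub>R v"] that by simp
    also have "\<dots> \<le> s * norm u + s * norm v"
      using that by (intro add_mono mult_right_mono) auto
    also have "\<dots> \<le> s * (norm u + norm v + 1)" using s by (simp add: algebra_simps)
    also have "\<dots> = d / 2" using pos by (simp add: s_def field_simps)
    also have "\<dots> < d" using d by simp
    finally show ?thesis .
  qed
  have inS: "x + a *\<^sub>R u + b *\<^sub>R v \<in> S" if "0 \<le> a" "a \<le> s" "0 \<le> b" "b \<le> s" for a b
    using near[OF that] d3 by (auto simp: d_def dist_commute subset_eq)
  obtain a b where ab: "0 < a" "a < s" "0 < b" "b < s"
    and 1: "F (x + s *\<^sub>R u + s *\<^sub>R v) - F (x + s *\<^sub>R u) - F (x + s *\<^sub>R v) + F x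
      = s * (s * ?P u v (x + a *\<^sub>R u + b *\<^sub>R v))"
    using second_difference_mvt[OF assms(3) s inS] by blast
  have inS': "x + a *\<^sub>R v + b *\<^sub>R u \<in> S" if "0 \<le> a" "a \<le> s" "0 \<le> b" "b \<le> s" for a b
    using inS[of b a] that by (simp add: algebra_simps)
  obtain a' b' where ab': "0 < a'" "a' < s" "0 < b'" "b' < s"
    and 2: "F (x + s *\<^sub>R v + s *\<^sub>R u) - F (x + s *\<^sub>R v) - F (x + s *\<^sub>R u) + F x
      = s * (s * ?P v u (x + a' *\<^sub>R v + b' *\<^sub>R u))"
    using second_difference_mvt[OF assms(3) s inS'] by blast
  have "F (x + s *\<^sub>R u + s *\<^sub>R v) = F (x + s *\<^sub>R v + s *\<^sub>R u)" by (simp add: add_ac)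
  with 1 2 have "s * (s * ?P u v (x + a *\<^sub>R u + b *\<^sub>R v)) = s * (s * ?P v u (x + a' *\<^sub>R v + b' *\<^sub>R u))"
    by linarith
  with s have "?P u v (x + a *\<^sub>R u + b *\<^sub>R v) = ?P v u (x + a' *\<^sub>R v + b' *\<^sub>R u)" by simp
  moreover have "dist (?P u v (x + a *\<^sub>R u + b *\<^sub>R v)) (?P u v x) < e"
    using near[of a b] ab by (intro d1) (auto simp: d_def)
  moreover have "dist (?P v u (x + a' *\<^sub>R v + b' *\<^sub>R u)) (?P v u x) < e"
    using near[of b' a'] ab' by (intro d2) (auto simp: d_def algebra_simps)
  ultimately show False unfolding e_def dist_real_def by argo
qed

section \<open>Tangent vectors and vector fields\<close>

lemma smooth_funD:
  "smooth_fun A f \<Longrightarrow> (U, \<phi>) \<in> A \<Longrightarrow> Ck_on k (\<phi> ` U) (\<lambda>z. f (inv_into U \<phi> z))"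
  by (auto simp: smooth_fun_def smooth_on_def o_def)

lemma smooth_funI:
  "(\<And>U \<phi> k. (U, \<phi>) \<in> A \<Longrightarrow> Ck_on k (\<phi> ` U) (\<lambda>z. f (inv_into U \<phi> z))) \<Longrightarrow> smooth_fun A f"
  by (auto simp: smooth_fun_def smooth_on_def o_def)

text \<open>Exposes the chart and the component vector that \<open>tangent_space\<close> hides
  behind existential quantifiers, so that a change of chart becomes a map of component
  vectors.\<close>

definition chart_vector ::
  "('a, 'e::euclidean_space) atlas \<Rightarrow> 'a set \<Rightarrow> ('a \<Rightarrow> 'e) \<Rightarrow> 'a \<Rightarrow> 'e \<Rightarrow> 'a tvec"
where
  "chart_vector A U \<phi> p e =
     (\<lambda>f. if smooth_fun A f
          then frechet_derivative (\<lambda>z. f (inv_into U \<phi> z)) (at (\<phi> p)) e else 0)"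

lemma tangent_space_altdef:
  "tangent_space A p = {chart_vector A U \<phi> p e | U \<phi> e. (U, \<phi>) \<in> A \<and> p \<in> U}"
  unfolding tangent_space_def chart_vector_def o_def by auto

lemma chart_vector_in_tangent_space:
  "(U, \<phi>) \<in> A \<Longrightarrow> p \<in> U \<Longrightarrow> chart_vector A U \<phi> p e \<in> tangent_space A p"
  by (auto simp: tangent_space_altdef)

lemma tangent_vector_not_smooth: "v \<in> tangent_space A p \<Longrightarrow> \<not> smooth_fun A f \<Longrightarrow> v f = 0"
  by (auto simp: tangent_space_altdef chart_vector_def)

lemma tangent_vector_const: "v \<in> tangent_space A p \<Longrightarrow> v (\<lambda>_. c) = 0"
  by (auto simp: tangent_space_altdef chart_vector_def)

lemma vector_field_in_tangent_space: "X \<in> vector_fields A \<Longrightarrow> X p \<in> tangent_space A p"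
  by (simp add: vector_fields_def)

lemma vector_field_smooth: "X \<in> vector_fields A \<Longrightarrow> smooth_fun A f \<Longrightarrow> smooth_fun A (\<lambda>p. X p f)"
  by (simp add: vector_fields_def)

text \<open>The squared distance is polynomial in the coordinates, so the function is of every class
  also at the centre, where the norm itself is not differentiable.\<close>

definition bump :: "'e::euclidean_space \<Rightarrow> real \<Rightarrow> 'e \<Rightarrow> real" where
  "bump c r z = flat_exp 0 (r\<^sup>2 - (z - c) \<bullet> (z - c))"

lemma bump_pos: "z \<in> ball c r \<Longrightarrow> bump c r z > 0"
  by (auto simp: bump_def flat_exp_def power2_norm_eq_inner[symmetric] dist_norm norm_minus_commute
      intro!: power_strict_mono)

lemma bump_eq_0: "z \<notin> cball c r \<Longrightarrow> r > 0 \<Longrightarrow> bump c r z = 0"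
  by (auto simp: bump_def flat_exp_def power2_norm_eq_inner[symmetric] dist_norm norm_minus_commute
      not_less intro!: power_mono)

lemma Ck_on_bump: "open S \<Longrightarrow> Ck_on k S (bump c r)"
proof -
  assume S: "open S"
  have "Ck_on k S (\<lambda>z. z - c)"
    by (intro Ck_on_diff S Ck_on_bounded_linear bounded_linear_ident Ck_on_const)
  then have inner: "Ck_on k S (\<lambda>z. (z - c) \<bullet> b)" for b
    by (intro Ck_on_bounded_linear_image[OF S bounded_linear_inner_left])
  have "Ck_on k S (\<lambda>z. \<Sum>b\<in>Basis. ((z - c) \<bullet> b) * ((z - c) \<bullet> b))"
    by (intro Ck_on_sum Ck_on_mult S inner)
  then have "Ck_on k S (\<lambda>z. (z - c) \<bullet> (z - c))"
    by (simp add: euclidean_inner[symmetric])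
  then have "Ck_on k S (\<lambda>z. r\<^sup>2 - (z - c) \<bullet> (z - c))"
    by (intro Ck_on_diff S Ck_on_const)
  from Ck_on_compose[OF S _ Ck_on_flat_exp this] show ?thesis
    by (simp add: bump_def[abs_def])
qed

section \<open>Charts, tangent spaces and smooth extensions\<close>

locale smooth_manifold =
  fixes A :: "('a::{t2_space, second_countable_topology}, 'e::euclidean_space) atlas"
  assumes atlas: "smooth_atlas A"
begin

lemma chart_at: obtains U \<phi> where "(U, \<phi>) \<in> A" "p \<in> U"
proof -
  have "(\<Union>(U, \<phi>)\<in>A. U) = UNIV"
    using atlas unfolding smooth_atlas_def by (elim conjE)
  then have "p \<in> (\<Union>(U, \<phi>)\<in>A. U)" by simp
  then show ?thesis using that by auto
qed

lemma chart_homeomorphism: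
  assumes "(U, \<phi>) \<in> A"
  shows "open U" "open (\<phi> ` U)" "homeomorphism U (\<phi> ` U) \<phi> (inv_into U \<phi>)"
proof -
  have "\<forall>(U, \<phi>)\<in>A. open U \<and> open (\<phi> ` U) \<and> homeomorphism U (\<phi> ` U) \<phi> (inv_into U \<phi>)"
    using atlas unfolding smooth_atlas_def by (elim conjE)
  from bspec[OF this assms]
  show "open U" "open (\<phi> ` U)" "homeomorphism U (\<phi> ` U) \<phi> (inv_into U \<phi>)" by simp_all
qed

lemma
  assumes "(U, \<phi>) \<in> A"
  shows open_domain: "open U" and open_range: "open (\<phi> ` U)"
    and continuous_inv_chart: "continuous_on (\<phi> ` U) (inv_into U \<phi>)"
    and inv_chart: "p \<in> U \<Longrightarrow> inv_into U \<phi> (\<phi> p) = p"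
  using chart_homeomorphism[OF assms] by (simp_all add: homeomorphism_def)

lemma chart_inj: "(U, \<phi>) \<in> A \<Longrightarrow> inj_on \<phi> U"
  by (metis inj_onI inv_chart)

lemma open_chart_image:
  assumes "(U, \<phi>) \<in> A" "open T" "T \<subseteq> U"
  shows "open (\<phi> ` T)"
proof -
  have "\<phi> ` T = inv_into U \<phi> -` T \<inter> \<phi> ` U"
    using assms inv_chart[OF assms(1)] by (auto simp: subset_eq)
  then show ?thesis
    using continuous_inv_chart[OF assms(1)] open_range[OF assms(1)] assms(2)
    by (metis continuous_on_open_vimage)
qed

lemma transition:
  assumes "(U, \<phi>) \<in> A" "(V, \<psi>) \<in> A"
  shows "Ck_on k (\<phi> ` (U \<inter> V)) (\<lambda>z. \<psi> (inv_into U \<phi> z))"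
proof -
  have "\<forall>(U, \<phi>)\<in>A. \<forall>(V, \<psi>)\<in>A. smooth_on (\<phi> ` (U \<inter> V)) (\<psi> \<circ> inv_into U \<phi>)"
    using atlas unfolding smooth_atlas_def by (elim conjE)
  from bspec[OF this assms(1)] assms(2) show ?thesis
    by (auto simp: smooth_on_def o_def)
qed

text \<open>Chain rule: near p, the expression of f in one chart is its expression in the other
  after the transition map, whose derivative therefore carries the components.\<close>

lemma chart_vector_change:
  assumes "(U, \<phi>) \<in> A" "(V, \<psi>) \<in> A" "p \<in> U" "p \<in> V"
  shows "chart_vector A U \<phi> p e
    = chart_vector A V \<psi> p (frechet_derivative (\<lambda>z. \<psi> (inv_into U \<phi> z)) (at (\<phi> p)) e)"
proof (rule ext)
  fix f :: "'a \<Rightarrow> real"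
  let ?g = "\<lambda>z. \<psi> (inv_into U \<phi> z)" and ?f = "\<lambda>z. f (inv_into V \<psi> z)"
  have p: "\<phi> p \<in> \<phi> ` (U \<inter> V)" using assms by auto
  have O: "open (\<phi> ` (U \<inter> V))"
    using assms by (intro open_chart_image[OF assms(1)]) (auto intro: open_domain)
  have gp: "?g (\<phi> p) = \<psi> p" using assms inv_chart by auto
  show "chart_vector A U \<phi> p e f = chart_vector A V \<psi> p (frechet_derivative ?g (at (\<phi> p)) e) f"
  proof (cases "smooth_fun A f")
    case True
    have "frechet_derivative (\<lambda>z. f (inv_into U \<phi> z)) (at (\<phi> p)) e
        = frechet_derivative (\<lambda>z. ?f (?g z)) (at (\<phi> p)) e"
      using frechet_derivative_cong_open[OF O p, of "\<lambda>z. f (inv_into U \<phi> z)" "\<lambda>z. ?f (?g z)"]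
        inv_chart[OF assms(1)] inv_chart[OF assms(2)] by fastforce
    also have "\<dots> = frechet_derivative ?f (at (?g (\<phi> p))) (frechet_derivative ?g (at (\<phi> p)) e)"
    proof (rule frechet_derivative_compose_at)
      show "?g differentiable at (\<phi> p)"
        using transition[OF assms(1,2), of 1] p by auto
      show "?f differentiable at (?g (\<phi> p))"
        using smooth_funD[OF True assms(2), of 1] assms(4) gp by auto
    qed
    finally show ?thesis using True gp by (simp add: chart_vector_def)
  qed (simp add: chart_vector_def)
qed

text \<open>The definition lets the chart vary with the vector. Bringing all vectors at p into one
  chart is what makes sums of tangent vectors tangent.\<close>

lemma tangent_space_chart:
  assumes "(U, \<phi>) \<in> A" "p \<in> U"
  shows "tangent_space A p = range (chart_vector A U \<phi> p)"
  unfolding tangent_space_altdef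
  using chart_vector_change[OF _ assms(1) _ assms(2)] assms by blast

lemma frechet_derivative_smooth_fun_linear:
  assumes "(U, \<phi>) \<in> A" "p \<in> U" "smooth_fun A f"
  shows "linear (frechet_derivative (\<lambda>z. f (inv_into U \<phi> z)) (at (\<phi> p)))"
  using smooth_funD[OF assms(3,1), of 1] assms(2) by (auto intro!: linear_frechet_derivative)

lemma chart_vector_add:
  assumes "(U, \<phi>) \<in> A" "p \<in> U"
  shows "chart_vector A U \<phi> p (e + e') = chart_vector A U \<phi> p e + chart_vector A U \<phi> p e'"
  using frechet_derivative_smooth_fun_linear[OF assms]
  by (auto simp: chart_vector_def fun_eq_iff linear_add)

lemma chart_vector_scale:
  assumes "(U, \<phi>) \<in> A" "p \<in> U"
  shows "chart_vector A U \<phi> p (c *\<^sub>R e) = c *\<^sub>T chart_vector A U \<phi> p e"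
  using frechet_derivative_smooth_fun_linear[OF assms]
  by (auto simp: chart_vector_def fun_eq_iff linear_cmul tscale_def)

lemma tangent_space_add:
  assumes "u \<in> tangent_space A p" "v \<in> tangent_space A p"
  shows "u + v \<in> tangent_space A p"
proof -
  obtain U \<phi> where U: "(U, \<phi>) \<in> A" "p \<in> U" by (rule chart_at)
  then show ?thesis
    using assms by (auto simp: tangent_space_chart[OF U] chart_vector_add[symmetric])
qed

lemma tangent_space_scale:
  assumes "u \<in> tangent_space A p"
  shows "c *\<^sub>T u \<in> tangent_space A p"
proof -
  obtain U \<phi> where U: "(U, \<phi>) \<in> A" "p \<in> U" by (rule chart_at)
  then show ?thesis
    using assms by (auto simp: tangent_space_chart[OF U] chart_vector_scale[symmetric])
qed

lemma tangent_space_zero: "0 \<in> tangent_space A p"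
proof -
  obtain U \<phi> where U: "(U, \<phi>) \<in> A" "p \<in> U" by (rule chart_at)
  then have "chart_vector A U \<phi> p 0 = 0"
    using chart_vector_scale[OF U, of 0 0] by (auto simp: tscale_def fun_eq_iff)
  then show ?thesis using tangent_space_chart[OF U] by (metis rangeI)
qed

lemma tangent_space_minus: "u \<in> tangent_space A p \<Longrightarrow> - u \<in> tangent_space A p"
  using tangent_space_scale[of u p "-1"] by (simp add: tscale_def fun_Compl_def)

lemma tangent_space_diff:
  "u \<in> tangent_space A p \<Longrightarrow> v \<in> tangent_space A p \<Longrightarrow> u - v \<in> tangent_space A p"
  using tangent_space_add[of u p "- v"] tangent_space_minus[of v p]
  by (simp add: fun_eq_iff)

text \<open>Serves the square of the time field, which is -\<beta> and has to be differentiated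
  along lifts.\<close>

lemma tangent_vector_uminus:
  assumes "v \<in> tangent_space A p" "smooth_fun A f"
  shows "v (\<lambda>x. - f x) = - v f" and "smooth_fun A (\<lambda>x. - f x)"
proof -
  show s: "smooth_fun A (\<lambda>x. - f x)"
    by (intro smooth_funI Ck_on_minus open_range smooth_funD[OF assms(2)])
  obtain U \<phi> e where U: "(U, \<phi>) \<in> A" "p \<in> U" "v = chart_vector A U \<phi> p e"
    using assms(1) by (auto simp: tangent_space_altdef)
  have "(\<lambda>z. f (inv_into U \<phi> z)) differentiable at (\<phi> p)"
    using smooth_funD[OF assms(2) U(1), of 1] U(2) by auto
  then have "((\<lambda>z. - f (inv_into U \<phi> z)) has_derivative
      (\<lambda>e. - frechet_derivative (\<lambda>z. f (inv_into U \<phi> z)) (at (\<phi> p)) e)) (at (\<phi> p))"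
    unfolding frechet_derivative_works by (rule has_derivative_minus)
  then show "v (\<lambda>x. - f x) = - v f"
    using U(3) s assms(2) by (simp add: chart_vector_def frechet_derivative_eqI)
qed

text \<open>Seen from another chart, a point of U has a neighbourhood where the function is F after
  a transition map. A point outside U has a neighbourhood missing \<open>K\<close>, the preimage of
  the closed ball, and there the function vanishes. The second case rests on \<open>K\<close> being
  closed, that is, on compactness of the ball and the Hausdorff property.\<close>

lemma smooth_fun_extend:
  assumes U: "(U, \<phi>) \<in> A" and F: "\<And>k. Ck_on k (\<phi> ` U) F"
    and r: "cball c r \<subseteq> \<phi> ` U" and 0: "\<And>z. z \<in> \<phi> ` U \<Longrightarrow> z \<notin> cball c r \<Longrightarrow> F z = 0"
  shows "smooth_fun A (\<lambda>p. if p \<in> U then F (\<phi> p) else 0)" (is "smooth_fun A ?h")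
proof (rule smooth_funI)
  fix V \<psi> k
  assume V: "(V, \<psi>) \<in> A"
  define K where "K = inv_into U \<phi> ` cball c r"
  have "compact K"
    unfolding K_def using continuous_inv_chart[OF U] r
    by (intro compact_continuous_image) (auto intro: continuous_on_subset)
  then have K: "closed K" by (rule compact_imp_closed)
  have KU: "K \<subseteq> U" using r by (auto simp: K_def intro!: inv_into_into)
  show "Ck_on k (\<psi> ` V) (\<lambda>z. ?h (inv_into V \<psi> z))"
  proof (rule Ck_on_local)
    fix z assume "z \<in> \<psi> ` V"
    then obtain q where q: "q \<in> V" "z = \<psi> q" by auto
    show "\<exists>T. open T \<and> z \<in> T \<and> Ck_on k T (\<lambda>z. ?h (inv_into V \<psi> z))"
    proof (cases "q \<in> U")
      case True
      let ?T = "\<psi> ` (V \<inter> U)"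
      have T: "open ?T"
        using open_domain[OF U] open_domain[OF V] by (intro open_chart_image[OF V]) auto
      have "Ck_on k ?T (\<lambda>z. F (\<phi> (inv_into V \<psi> z)))"
        by (rule Ck_on_compose[OF T _ F transition[OF V U]]) (auto simp: inv_chart[OF V])
      then have "Ck_on k ?T (\<lambda>z. ?h (inv_into V \<psi> z))"
        by (rule Ck_on_cong[OF T, rotated]) (auto simp: inv_chart[OF V])
      then show ?thesis using T q True by blast
    next
      case False
      let ?T = "\<psi> ` (V - K)"
      have T: "open ?T"
        using open_domain[OF V] K by (intro open_chart_image[OF V]) auto
      have "F (\<phi> q') = 0" if "q' \<in> U" "q' \<notin> K" for q'
      proof (rule 0)
        show "\<phi> q' \<notin> cball c r"
          using that inv_chart[OF U that(1)] unfolding K_def by (metis image_eqI)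
      qed (use that in simp)
      then have "Ck_on k ?T (\<lambda>z. ?h (inv_into V \<psi> z))"
        by (intro Ck_on_cong[OF T _ Ck_on_const[of _ _ 0]]) (auto simp: inv_chart[OF V])
      then show ?thesis using T q False KU by blast
    qed
  qed
qed

lemma cball_in_chart:
  assumes "(U, \<phi>) \<in> A" "p \<in> U"
  obtains r where "r > 0" "cball (\<phi> p) r \<subseteq> \<phi> ` U"
  using open_range[OF assms(1)] assms(2) open_contains_cball by blast

text \<open>Constant components in a chart, cut off by a bump function normalised to the value 1 at
  p. This links conditions on single tangent vectors with \<open>levi_civita\<close> and
  \<open>sharp\<close>, which quantify over vector fields.\<close>

lemma vector_field_extending:
  assumes "v \<in> tangent_space A p"
  obtains Y where "Y \<in> vector_fields A" "Y p = v"
proof -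
  obtain U \<phi> e where U: "(U, \<phi>) \<in> A" "p \<in> U" and v: "v = chart_vector A U \<phi> p e"
    using assms by (auto simp: tangent_space_altdef)
  obtain r where r: "r > 0" "cball (\<phi> p) r \<subseteq> \<phi> ` U" by (rule cball_in_chart[OF U])
  define \<eta> where "\<eta> z = bump (\<phi> p) r z * inverse (bump (\<phi> p) r (\<phi> p))" for z
  have \<eta>: "Ck_on k (\<phi> ` U) \<eta>" for k
    unfolding \<eta>_def using open_range[OF U(1)]
    by (intro Ck_on_mult Ck_on_bump Ck_on_const)
  define Y where "Y q = (if q \<in> U then \<eta> (\<phi> q) *\<^sub>T chart_vector A U \<phi> q e else 0)" for q
  have "Y \<in> vector_fields A"
    unfolding vector_fields_def
  proof (intro CollectI conjI allI impI)
    show "Y q \<in> tangent_space A q" for q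
      using U(1) by (simp add: Y_def tangent_space_scale tangent_space_zero chart_vector_in_tangent_space)
    fix f assume f: "smooth_fun A f"
    let ?F = "\<lambda>z. \<eta> z * frechet_derivative (\<lambda>z. f (inv_into U \<phi> z)) (at z) e"
    have "smooth_fun A (\<lambda>q. if q \<in> U then ?F (\<phi> q) else 0)"
    proof (rule smooth_fun_extend[OF U(1) _ r(2)])
      show "Ck_on k (\<phi> ` U) ?F" for k
        using smooth_funD[OF f U(1), of "Suc k"] by (intro Ck_on_mult open_range[OF U(1)] \<eta>) simp
      show "?F z = 0" if "z \<notin> cball (\<phi> p) r" for z
        using bump_eq_0[OF that r(1)] by (simp add: \<eta>_def)
    qed
    then show "smooth_fun A (\<lambda>q. Y q f)"
      using f by (simp add: Y_def chart_vector_def tscale_def if_distrib[of "\<lambda>v. v f"] cong: if_cong)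
  qed
  moreover have "Y p = v"
    using U(2) v bump_pos[of "\<phi> p" "\<phi> p" r] r(1) by (simp add: Y_def \<eta>_def tscale_def)
  ultimately show ?thesis by (rule that)
qed

text \<open>
  The components of \<open>V\<close> are read off by applying \<open>V\<close> to cut-off coordinate functions
  \<open>\<eta> z\<^sub>b\<close>: by the product rule \<open>\<eta> V\<^sub>b = V (\<eta> z\<^sub>b) - z\<^sub>b V \<eta>\<close>.
\<close>

lemma vector_field_components:
  assumes V: "V \<in> vector_fields A" and U: "(U, \<phi>) \<in> A" "p \<in> U"
  obtains T c where "open T" "\<phi> p \<in> T" "T \<subseteq> \<phi> ` U"
    "\<And>k b. b \<in> Basis \<Longrightarrow> Ck_on k T (\<lambda>z. c z \<bullet> b)"
    "\<And>z. z \<in> T \<Longrightarrow> V (inv_into U \<phi> z) = chart_vector A U \<phi> (inv_into U \<phi> z) (c z)"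
proof -
  obtain r where r: "r > 0" "cball (\<phi> p) r \<subseteq> \<phi> ` U" by (rule cball_in_chart[OF U])
  define \<eta> where "\<eta> = bump (\<phi> p) r"
  define T where "T = ball (\<phi> p) r"
  have T: "open T" "\<phi> p \<in> T" "T \<subseteq> \<phi> ` U"
    using r ball_subset_cball[of "\<phi> p" r] by (auto simp: T_def)
  have inU: "inv_into U \<phi> z \<in> U" "\<phi> (inv_into U \<phi> z) = z" if "z \<in> \<phi> ` U" for z
    using that inv_chart[OF U(1)] by auto
  \<comment> \<open>The components are chosen point by point and carry no regularity at first; it is
    recovered from the explicit formula \<open>?c\<close>.\<close>
  have "\<exists>e. V (inv_into U \<phi> z) = chart_vector A U \<phi> (inv_into U \<phi> z) e" if "z \<in> \<phi> ` U" for z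
    using vector_field_in_tangent_space[OF V, of "inv_into U \<phi> z"]
      tangent_space_chart[OF U(1) inU(1)[OF that]] by auto
  then obtain c where c: "\<And>z. z \<in> \<phi> ` U \<Longrightarrow> V (inv_into U \<phi> z) = chart_vector A U \<phi> (inv_into U \<phi> z) (c z)"
    by metis
  have O: "open (\<phi> ` U)" by (rule open_range[OF U(1)])
  \<comment> \<open>\<open>h F\<close> is a global function equal to \<eta> F in the chart, so V may
    be applied to it. The choices F = z_b and F = 1 give the two functions of the product rule
    identity.\<close>
  define h where "h F p = (if p \<in> U then \<eta> (\<phi> p) * F (\<phi> p) else 0)" for F p
  have h: "smooth_fun A (h F)" if "\<And>k. Ck_on k (\<phi> ` U) F" for F
    unfolding h_def[abs_def]
  proof (rule smooth_fun_extend[OF U(1) _ r(2), of "\<lambda>z. \<eta> z * F z"])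
    show "Ck_on k (\<phi> ` U) (\<lambda>z. \<eta> z * F z)" for k
      unfolding \<eta>_def by (intro Ck_on_mult O Ck_on_bump that)
  qed (simp add: bump_eq_0[OF _ r(1)] \<eta>_def)
  have Vh: "V (inv_into U \<phi> z) (h F) = frechet_derivative (\<lambda>z. \<eta> z * F z) (at z) (c z)"
    if F: "\<And>k. Ck_on k (\<phi> ` U) F" and z: "z \<in> \<phi> ` U" for F z
  proof -
    have "frechet_derivative (\<lambda>z. h F (inv_into U \<phi> z)) (at z) = frechet_derivative (\<lambda>z. \<eta> z * F z) (at z)"
      by (rule frechet_derivative_cong_open[OF O z]) (simp add: h_def inU)
    then show ?thesis
      using c[OF z] h[OF F] inU[OF z] by (simp add: chart_vector_def)
  qed
  have one: "Ck_on k (\<phi> ` U) (\<lambda>_. 1 :: real)" for k by (rule Ck_on_const)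
  have coord: "Ck_on k S (\<lambda>z. z \<bullet> b)" for k b and S :: "'e set"
    by (rule Ck_on_bounded_linear[OF bounded_linear_inner_left])
  have d\<eta>: "\<eta> differentiable at z" for z
    using Ck_on_bump[OF open_UNIV, of 1 "\<phi> p" r] by (simp add: \<eta>_def)
  \<comment> \<open>The product rule identity solved for the component; the division is legitimate
    on \<open>T\<close>, where \<eta> is positive.\<close>
  let ?c = "\<lambda>b z. (V (inv_into U \<phi> z) (h (\<lambda>z. z \<bullet> b)) - (z \<bullet> b) * V (inv_into U \<phi> z) (h (\<lambda>_. 1)))
      * inverse (\<eta> z)"
  have eq: "?c b z = c z \<bullet> b" if "z \<in> T" for z b
  proof -
    have z: "z \<in> \<phi> ` U" using that T by auto
    have "((\<lambda>z. \<eta> z * (z \<bullet> b)) has_derivative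
        (\<lambda>v. \<eta> z * (v \<bullet> b) + frechet_derivative \<eta> (at z) v * (z \<bullet> b))) (at z)"
      by (intro has_derivative_mult has_derivative_inner_left has_derivative_ident
          d\<eta>[unfolded frechet_derivative_works])
    then have "V (inv_into U \<phi> z) (h (\<lambda>z. z \<bullet> b))
        = \<eta> z * (c z \<bullet> b) + frechet_derivative \<eta> (at z) (c z) * (z \<bullet> b)"
      using Vh[OF coord z] by (simp add: frechet_derivative_eqI)
    moreover have "V (inv_into U \<phi> z) (h (\<lambda>_. 1)) = frechet_derivative \<eta> (at z) (c z)"
      using Vh[OF one z] by simp
    moreover have "\<eta> z \<noteq> 0" using bump_pos[of z] that by (fastforce simp: \<eta>_def T_def)
    ultimately show ?thesis by (simp add: field_simps)
  qed
  have ck: "Ck_on k T (?c b)" for k b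
  proof -
    have "Ck_on k T (\<lambda>z. V (inv_into U \<phi> z) (h F))" if "\<And>k. Ck_on k (\<phi> ` U) F" for F
      by (rule Ck_on_subset[OF smooth_funD[OF vector_field_smooth[OF V h[OF that]] U(1)] T(3)])
    moreover have "Ck_on k T (\<lambda>z. inverse (\<eta> z))"
      unfolding \<eta>_def
      by (rule Ck_on_compose[OF T(1) _ Ck_on_inverse Ck_on_bump[OF T(1)]]) (simp add: bump_pos T_def)
    ultimately show ?thesis
      using one coord by (intro Ck_on_mult Ck_on_diff T(1)) auto
  qed
  have "Ck_on k T (\<lambda>z. c z \<bullet> b)" for k b
    by (rule Ck_on_cong[OF T(1) eq ck])
  then show ?thesis
    using c T by (intro that[of T c]) (blast+)
qed

end

section \<open>The product with the time axis\<close>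

lemma has_derivative_partials:
  fixes F :: "real \<times> 'e::euclidean_space \<Rightarrow> real"
  assumes "F differentiable at (t, z)"
  shows "((\<lambda>s. F (s, z)) has_real_derivative frechet_derivative F (at (t, z)) (1, 0)) (at t)"
    and "((\<lambda>y. F (t, y)) has_derivative (\<lambda>e. frechet_derivative F (at (t, z)) (0, e))) (at z)"
proof -
  have D: "(F has_derivative frechet_derivative F (at (t, z))) (at (t, z))"
    using assms by (simp add: frechet_derivative_works)
  have "((\<lambda>s. F (s, z)) has_derivative (\<lambda>s. frechet_derivative F (at (t, z)) (s, 0))) (at t)"
    by (rule has_derivative_compose[of "\<lambda>s. (s, z)", OF _ D]) (auto intro!: derivative_eq_intros)
  moreover have "(\<lambda>s. frechet_derivative F (at (t, z)) (s, 0)) = (*) (frechet_derivative F (at (t, z)) (1, 0))"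
  proof
    fix s :: real
    show "frechet_derivative F (at (t, z)) (s, 0) = frechet_derivative F (at (t, z)) (1, 0) * s"
      using linear_cmul[OF linear_frechet_derivative[OF assms], of s "(1, 0)"]
      by (simp add: mult.commute)
  qed
  ultimately show "((\<lambda>s. F (s, z)) has_real_derivative frechet_derivative F (at (t, z)) (1, 0)) (at t)"
    by (simp only: has_field_derivative_def)
  show "((\<lambda>y. F (t, y)) has_derivative (\<lambda>e. frechet_derivative F (at (t, z)) (0, e))) (at z)"
    by (rule has_derivative_compose[of "\<lambda>y. (t, y)", OF _ D]) (auto intro!: derivative_eq_intros)
qed

lemma frechet_derivative_time_space:
  fixes F :: "real \<times> 'e::euclidean_space \<Rightarrow> real"
  assumes "F differentiable at w"
  shows "frechet_derivative F (at w) (\<tau>, e)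
    = \<tau> * frechet_derivative F (at w) (1, 0) + frechet_derivative F (at w) (0, e)"
proof -
  note lin = linear_frechet_derivative[OF assms]
  show ?thesis
    using linear_add[OF lin, of "\<tau> *\<^sub>R (1, 0)" "(0, e)"] linear_cmul[OF lin, of \<tau> "(1, 0)"] by simp
qed

lemma Ck_on_cong_iff:
  "open S \<Longrightarrow> (\<And>y. y \<in> S \<Longrightarrow> f y = g y) \<Longrightarrow> Ck_on k S f \<longleftrightarrow> Ck_on k S g"
  by (metis Ck_on_cong)

section \<open>The Koszul formula\<close>

lemma lie_bracket_self: "lie_bracket X X = 0"
  by (simp add: lie_bracket_def fun_eq_iff)

text \<open>Compatibility expands the three derivatives, torsion-freeness turns each bracket into a
  difference of covariant derivatives, and by symmetry everything cancels except two copies of the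
  wanted product. Asking of G only symmetry and subtractivity at p makes it apply to the Riemannian
  metric and to the indefinite one alike.\<close>

lemma koszul_formula:
  assumes lc: "levi_civita B G nabla"
    and X: "X \<in> vector_fields B" and Y: "Y \<in> vector_fields B" and Z: "Z \<in> vector_fields B"
    and sym: "\<And>u v. \<lbrakk>u \<in> tangent_space B p; v \<in> tangent_space B p\<rbrakk> \<Longrightarrow> G p u v = G p v u"
    and diff: "\<And>u v w. \<lbrakk>u \<in> tangent_space B p; v \<in> tangent_space B p; w \<in> tangent_space B p\<rbrakk>
      \<Longrightarrow> G p (u - v) w = G p u w - G p v w"
  shows "2 * G p (nabla X Y p) (Z p) =
      X p (\<lambda>q. G q (Y q) (Z q)) + Y p (\<lambda>q. G q (X q) (Z q)) - Z p (\<lambda>q. G q (X q) (Y q))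
      + G p (lie_bracket X Y p) (Z p) - G p (lie_bracket X Z p) (Y p) - G p (lie_bracket Y Z p) (X p)"
proof -
  have nabla: "nabla X' Y' p \<in> tangent_space B p"
    if "X' \<in> vector_fields B" "Y' \<in> vector_fields B" for X' Y'
  proof -
    have "\<forall>X\<in>vector_fields B. \<forall>Y\<in>vector_fields B. nabla X Y \<in> vector_fields B"
      using lc unfolding levi_civita_def affine_connection_def by (elim conjE)
    with that show ?thesis by (simp add: vector_field_in_tangent_space)
  qed
  have torsion: "lie_bracket X' Y' p = nabla X' Y' p - nabla Y' X' p"
    if "X' \<in> vector_fields B" "Y' \<in> vector_fields B" for X' Y'
  proof -
    have "\<forall>X\<in>vector_fields B. \<forall>Y\<in>vector_fields B. nabla X Y - nabla Y X = lie_bracket X Y"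
      using lc unfolding levi_civita_def by (elim conjE)
    with that show ?thesis by (simp flip: minus_apply)
  qed
  have compat: "X' p (\<lambda>q. G q (Y' q) (Z' q)) = G p (nabla X' Y' p) (Z' p) + G p (Y' p) (nabla X' Z' p)"
    if "X' \<in> vector_fields B" "Y' \<in> vector_fields B" "Z' \<in> vector_fields B" for X' Y' Z'
  proof -
    have "\<forall>X\<in>vector_fields B. \<forall>Y\<in>vector_fields B. \<forall>Z\<in>vector_fields B. \<forall>p.
        X p (\<lambda>q. G q (Y q) (Z q)) = G p (nabla X Y p) (Z p) + G p (Y p) (nabla X Z p)"
      using lc unfolding levi_civita_def by (elim conjE)
    with that show ?thesis by blast
  qed
  note tan = X[THEN vector_field_in_tangent_space, of p] Y[THEN vector_field_in_tangent_space, of p]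
    Z[THEN vector_field_in_tangent_space, of p]
  show ?thesis
    using X Y Z tan
    by (simp add: compat torsion diff nabla sym[of "X p"] sym[of "Y p"])
qed

section \<open>Charts, smooth functions and tangent vectors of the product\<close>

context smooth_manifold
begin

abbreviation spacetime :: "(real \<times> 'a, real \<times> 'e) atlas" where
  "spacetime \<equiv> spacetime_atlas A"

abbreviation spacetime_chart :: "('a \<Rightarrow> 'e) \<Rightarrow> real \<times> 'a \<Rightarrow> real \<times> 'e" where
  "spacetime_chart \<phi> \<equiv> (\<lambda>(t, x). (t, \<phi> x))"

lemma in_spacetime_atlas:
  "(U', \<Phi>) \<in> spacetime \<longleftrightarrow> (\<exists>U \<phi>. (U, \<phi>) \<in> A \<and> U' = UNIV \<times> U \<and> \<Phi> = spacetime_chart \<phi>)"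
  by (simp add: spacetime_atlas_def image_iff Bex_def)

lemma spacetime_chart_image: "spacetime_chart \<phi> ` (UNIV \<times> U) = UNIV \<times> \<phi> ` U"
  by auto

lemma inv_spacetime_chart:
  assumes "(U, \<phi>) \<in> A" "w \<in> UNIV \<times> \<phi> ` U"
  shows "inv_into (UNIV \<times> U) (spacetime_chart \<phi>) w = (fst w, inv_into U \<phi> (snd w))"
proof (rule inv_into_f_eq)
  show "inj_on (spacetime_chart \<phi>) (UNIV \<times> U)"
    using chart_inj[OF assms(1)] by (auto simp: inj_on_def)
qed (use assms inv_chart[OF assms(1)] in auto)

lemma open_spacetime_range: "(U, \<phi>) \<in> A \<Longrightarrow> open (UNIV \<times> \<phi> ` U :: (real \<times> 'e) set)"
  by (intro open_Times open_UNIV open_range)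

text \<open>Trades the inverse of a product chart, given by choice, for the explicit product of the
  identity with the inverse of a chart of the base. Calculations in product charts start from this
  form.\<close>

lemma smooth_fun_spacetime_iff:
  "smooth_fun spacetime f \<longleftrightarrow>
    (\<forall>U \<phi> k. (U, \<phi>) \<in> A \<longrightarrow> Ck_on k (UNIV \<times> \<phi> ` U) (\<lambda>w. f (fst w, inv_into U \<phi> (snd w))))"
proof -
  have "Ck_on k (UNIV \<times> \<phi> ` U) (f \<circ> inv_into (UNIV \<times> U) (spacetime_chart \<phi>))
      \<longleftrightarrow> Ck_on k (UNIV \<times> \<phi> ` U) (\<lambda>w. f (fst w, inv_into U \<phi> (snd w)))"
    if "(U, \<phi>) \<in> A" for U \<phi> k
    by (rule Ck_on_cong_iff[OF open_spacetime_range[OF that]])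
       (simp only: o_def inv_spacetime_chart[OF that])
  then show ?thesis
    unfolding smooth_fun_def smooth_on_def
    by (auto simp: spacetime_atlas_def spacetime_chart_image)
qed

lemma smooth_fun_spacetimeD:
  "smooth_fun spacetime f \<Longrightarrow> (U, \<phi>) \<in> A \<Longrightarrow>
    Ck_on k (UNIV \<times> \<phi> ` U) (\<lambda>w. f (fst w, inv_into U \<phi> (snd w)))"
  by (simp add: smooth_fun_spacetime_iff)

lemma smooth_fun_slice:
  assumes "smooth_fun spacetime f"
  shows "smooth_fun A (\<lambda>x. f (t, x))"
proof (rule smooth_funI)
  fix U \<phi> k assume U: "(U, \<phi>) \<in> A"
  have "Ck_on k (\<phi> ` U) (\<lambda>z. (t, 0) + (0, z))"
    by (intro Ck_on_add open_range[OF U] Ck_on_const Ck_on_bounded_linear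
        bounded_linear_Pair bounded_linear_zero bounded_linear_ident)
  then have "Ck_on k (\<phi> ` U) (\<lambda>z. (t, z))" by simp
  from Ck_on_compose[OF open_range[OF U] _ smooth_fun_spacetimeD[OF assms U] this]
  show "Ck_on k (\<phi> ` U) (\<lambda>z. f (t, inv_into U \<phi> z))" by simp
qed

lemma smooth_fun_snd:
  assumes "smooth_fun A h"
  shows "smooth_fun spacetime (\<lambda>p. h (snd p))"
  unfolding smooth_fun_spacetime_iff
proof (intro allI impI)
  fix U \<phi> k assume U: "(U, \<phi>) \<in> A"
  have "Ck_on k (UNIV \<times> \<phi> ` U :: (real \<times> 'e) set) (\<lambda>w. h (inv_into U \<phi> (snd w)))"
    by (rule Ck_on_compose[OF open_spacetime_range[OF U] _ smooth_funD[OF assms U]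
        Ck_on_bounded_linear[OF bounded_linear_snd]]) auto
  then show "Ck_on k (UNIV \<times> \<phi> ` U) (\<lambda>w. h (snd (fst w :: real, inv_into U \<phi> (snd w))))"
    by simp
qed

lemma smooth_fun_snd_iff: "smooth_fun spacetime (\<lambda>p. h (snd p)) \<longleftrightarrow> smooth_fun A h"
  using smooth_fun_slice[of "\<lambda>p. h (snd p)" 0] smooth_fun_snd by auto

lemma smooth_fun_fst: "smooth_fun spacetime fst"
  by (simp add: smooth_fun_spacetime_iff Ck_on_bounded_linear bounded_linear_fst)

lemma spacetime_partials:
  assumes f: "smooth_fun spacetime f" and U: "(U, \<phi>) \<in> A" "x \<in> U"
  defines "F \<equiv> \<lambda>w. f (fst w, inv_into U \<phi> (snd w))"
  shows "F differentiable at (t, \<phi> x)"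
    and "deriv (\<lambda>s. f (s, x)) t = frechet_derivative F (at (t, \<phi> x)) (1, 0)"
    and "chart_vector A U \<phi> x e (\<lambda>y. f (t, y)) = frechet_derivative F (at (t, \<phi> x)) (0, e)"
proof -
  show F: "F differentiable at (t, \<phi> x)"
    using smooth_fun_spacetimeD[OF f U(1), of 1] U(2) by (auto simp: F_def)
  show "deriv (\<lambda>s. f (s, x)) t = frechet_derivative F (at (t, \<phi> x)) (1, 0)"
    using DERIV_imp_deriv[OF has_derivative_partials(1)[OF F]] inv_chart[OF U] by (simp add: F_def)
  show "chart_vector A U \<phi> x e (\<lambda>y. f (t, y)) = frechet_derivative F (at (t, \<phi> x)) (0, e)"
    using frechet_derivative_eqI[OF has_derivative_partials(2)[OF F]] smooth_fun_slice[OF f]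
    by (simp add: F_def chart_vector_def)
qed

text \<open>Linearity of the total derivative splits the direction (\<tau>, e) into its time and
  space parts, which are the two summands of \<open>tvec_pair\<close>.\<close>

lemma chart_vector_spacetime:
  assumes "(U, \<phi>) \<in> A" "x \<in> U"
  shows "chart_vector spacetime (UNIV \<times> U) (spacetime_chart \<phi>) (t, x) (\<tau>, e)
    = tvec_pair A (t, x) \<tau> (chart_vector A U \<phi> x e)"
proof (rule ext)
  fix f :: "real \<times> 'a \<Rightarrow> real"
  show "chart_vector spacetime (UNIV \<times> U) (spacetime_chart \<phi>) (t, x) (\<tau>, e) f
    = tvec_pair A (t, x) \<tau> (chart_vector A U \<phi> x e) f"
  proof (cases "smooth_fun spacetime f")
    case True
    let ?F = "\<lambda>w. f (fst w, inv_into U \<phi> (snd w))"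
    have "frechet_derivative (\<lambda>w. f (inv_into (UNIV \<times> U) (spacetime_chart \<phi>) w)) (at (t, \<phi> x))
        = frechet_derivative ?F (at (t, \<phi> x))"
      by (rule frechet_derivative_cong_open[OF open_spacetime_range[OF assms(1)]])
         (use assms in \<open>auto simp: inv_spacetime_chart\<close>)
    then show ?thesis
      using True spacetime_partials[OF True assms]
      by (simp add: chart_vector_def[of spacetime] tvec_pair_def frechet_derivative_time_space[of ?F _ \<tau>])
  qed (simp add: chart_vector_def tvec_pair_def)
qed

lemma tangent_space_spacetime:
  "tangent_space spacetime (t, x) = {tvec_pair A (t, x) \<tau> v | \<tau> v. v \<in> tangent_space A x}"
proof -
  have "tangent_space spacetime (t, x)
      = {chart_vector spacetime (UNIV \<times> U) (spacetime_chart \<phi>) (t, x) (\<tau>, e) | U \<phi> \<tau> e. (U, \<phi>) \<in> A \<and> x \<in> U}"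
    unfolding tangent_space_altdef[of spacetime] by (auto simp: in_spacetime_atlas)
  also have "\<dots> = {tvec_pair A (t, x) \<tau> (chart_vector A U \<phi> x e) | U \<phi> \<tau> e. (U, \<phi>) \<in> A \<and> x \<in> U}"
    by (rule Collect_cong) (metis chart_vector_spacetime)
  also have "\<dots> = {tvec_pair A (t, x) \<tau> v | \<tau> v. v \<in> tangent_space A x}"
    unfolding tangent_space_altdef by blast
  finally show ?thesis .
qed

lemma tvec_pair_in_tangent_space:
  "v \<in> tangent_space A x \<Longrightarrow> tvec_pair A (t, x) \<tau> v \<in> tangent_space spacetime (t, x)"
  by (auto simp: tangent_space_spacetime)

text \<open>On a slice the time coordinate is constant, so the space part contributes
  nothing.\<close>

lemma d_time_tvec_pair: "v \<in> tangent_space A x \<Longrightarrow> d_time (tvec_pair A (t, x) \<tau> v) = \<tau>"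
  by (simp add: d_time_def tvec_pair_def smooth_fun_fst tangent_vector_const)

text \<open>An equality of operators on all functions: \<open>h \<circ> snd\<close> is smooth
  exactly when \<open>h\<close> is, so both sides take their default value 0 on the same
  functions.\<close>

lemma d_space_tvec_pair: "v \<in> tangent_space A x \<Longrightarrow> d_space (tvec_pair A (t, x) \<tau> v) = v"
  by (auto simp: d_space_def tvec_pair_def o_def smooth_fun_snd_iff fun_eq_iff tangent_vector_not_smooth)

lemma tvec_pair_diff: "tvec_pair A p \<tau> v - tvec_pair A p \<sigma> w = tvec_pair A p (\<tau> - \<sigma>) (v - w)"
  by (auto simp: tvec_pair_def fun_eq_iff algebra_simps)

section \<open>The time field and the lifts as smooth vector fields\<close>

lemma time_field_apply:
  "smooth_fun spacetime f \<Longrightarrow> time_field A (t, x) f = deriv (\<lambda>s. f (s, x)) t"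
  by (simp add: time_field_def tvec_pair_def)

lemma lift_apply:
  "smooth_fun spacetime f \<Longrightarrow> lift A V (t, x) f = V x (\<lambda>y. f (t, y))"
  by (simp add: lift_def tvec_pair_def)

lemma time_field_vector_field: "time_field A \<in> vector_fields spacetime"
  unfolding vector_fields_def
proof (intro CollectI conjI allI impI)
  show "time_field A p \<in> tangent_space spacetime p" for p
    by (cases p) (simp add: time_field_def tvec_pair_in_tangent_space tangent_space_zero)
  fix f assume f: "smooth_fun spacetime f"
  show "smooth_fun spacetime (\<lambda>p. time_field A p f)"
    unfolding smooth_fun_spacetime_iff
  proof (intro allI impI)
    fix U \<phi> k assume U: "(U, \<phi>) \<in> A"
    let ?F = "\<lambda>w. f (fst w, inv_into U \<phi> (snd w))"
    show "Ck_on k (UNIV \<times> \<phi> ` U) (\<lambda>w. time_field A (fst w, inv_into U \<phi> (snd w)) f)"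
    proof (rule Ck_on_cong[OF open_spacetime_range[OF U]])
      show "Ck_on k (UNIV \<times> \<phi> ` U) (\<lambda>w. frechet_derivative ?F (at w) (1, 0))"
        using smooth_fun_spacetimeD[OF f U, of "Suc k"] by simp
      show "frechet_derivative ?F (at w) (1, 0) = time_field A (fst w, inv_into U \<phi> (snd w)) f"
        if "w \<in> UNIV \<times> \<phi> ` U" for w
        using that spacetime_partials(2)[OF f U] inv_chart[OF U] by (auto simp: time_field_apply f)
    qed
  qed
qed

text \<open>With smooth components c of V in a chart, the lift acts on f as the sum of c_b times the
  space derivatives of f in product coordinates. Both factors are of every class jointly in t and
  x.\<close>

lemma lift_vector_field:
  assumes V: "V \<in> vector_fields A"
  shows "lift A V \<in> vector_fields spacetime"
  unfolding vector_fields_def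
proof (intro CollectI conjI allI impI)
  show "lift A V p \<in> tangent_space spacetime p" for p
    by (cases p) (simp add: lift_def tvec_pair_in_tangent_space vector_field_in_tangent_space V)
  fix f assume f: "smooth_fun spacetime f"
  show "smooth_fun spacetime (\<lambda>p. lift A V p f)"
    unfolding smooth_fun_spacetime_iff
  proof (intro allI impI)
    fix U \<phi> k assume U: "(U, \<phi>) \<in> A"
    let ?F = "\<lambda>w. f (fst w, inv_into U \<phi> (snd w))"
    show "Ck_on k (UNIV \<times> \<phi> ` U) (\<lambda>w. lift A V (fst w, inv_into U \<phi> (snd w)) f)"
    \<comment> \<open>Smooth components of V are known only on a small set \<open>T\<close> around
      each point of the chart range.\<close>
    proof (rule Ck_on_local)
      fix w0 :: "real \<times> 'e" assume "w0 \<in> UNIV \<times> \<phi> ` U"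
      then obtain p where p: "p \<in> U" "snd w0 = \<phi> p" by auto
      obtain T c where T: "open T" "\<phi> p \<in> T" "T \<subseteq> \<phi> ` U"
        and c: "\<And>k b. b \<in> Basis \<Longrightarrow> Ck_on k T (\<lambda>z. c z \<bullet> b)"
        and Vc: "\<And>z. z \<in> T \<Longrightarrow> V (inv_into U \<phi> z) = chart_vector A U \<phi> (inv_into U \<phi> z) (c z)"
        using vector_field_components[OF V U p(1)] by metis
      have O: "open (UNIV \<times> T :: (real \<times> 'e) set)" using T(1) by (intro open_Times open_UNIV)
      have F: "Ck_on j (UNIV \<times> T) ?F" for j
        by (rule Ck_on_subset[OF smooth_fun_spacetimeD[OF f U]]) (use T(3) in auto)
      have "Ck_on k (UNIV \<times> T) (\<lambda>w. lift A V (fst w, inv_into U \<phi> (snd w)) f)"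
      proof (rule Ck_on_cong[OF O])
        have "Ck_on k (UNIV \<times> T :: (real \<times> 'e) set) (\<lambda>w. c (snd w) \<bullet> b)" if "b \<in> Basis" for b
          by (rule Ck_on_compose[where f = "\<lambda>z. c z \<bullet> b", OF O _ c[OF that]
                Ck_on_bounded_linear[OF bounded_linear_snd]]) auto
        moreover have "Ck_on k (UNIV \<times> T) (\<lambda>w. frechet_derivative ?F (at w) (0, b))" for b
          using F[of "Suc k"] by simp
        ultimately show "Ck_on k (UNIV \<times> T)
            (\<lambda>w. \<Sum>b\<in>Basis. (c (snd w) \<bullet> b) *\<^sub>R frechet_derivative ?F (at w) (0, b))"
          by (intro Ck_on_sum Ck_on_scaleR O)
        fix w :: "real \<times> 'e" assume w: "w \<in> UNIV \<times> T"
        obtain t z where tz: "w = (t, z)" "z \<in> T" using w by auto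
        then have x: "inv_into U \<phi> z \<in> U" "\<phi> (inv_into U \<phi> z) = z"
          using T(3) inv_chart[OF U] by auto
        have lin: "linear (frechet_derivative ?F (at (t, z)))"
          using spacetime_partials(1)[OF f U x(1), of t] x(2) by (intro linear_frechet_derivative) simp
        have "linear (\<lambda>e. frechet_derivative ?F (at (t, z)) (0, e))"
        proof (rule linearI)
          fix r and e e' :: 'e
          show "frechet_derivative ?F (at (t, z)) (0, e + e')
              = frechet_derivative ?F (at (t, z)) (0, e) + frechet_derivative ?F (at (t, z)) (0, e')"
            using linear_add[OF lin, of "(0, e)" "(0, e')"] by simp
          show "frechet_derivative ?F (at (t, z)) (0, r *\<^sub>R e)
              = r *\<^sub>R frechet_derivative ?F (at (t, z)) (0, e)"
            using linear_cmul[OF lin, of r "(0, e)"] by simp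
        qed
        from linear_euclidean_sum[OF this, of "c z"]
        show "(\<Sum>b\<in>Basis. (c (snd w) \<bullet> b) *\<^sub>R frechet_derivative ?F (at w) (0, b))
            = lift A V (fst w, inv_into U \<phi> (snd w)) f"
          using spacetime_partials(3)[OF f U x(1), of "c z" t] x(2) Vc[OF tz(2)] tz(1)
          by (simp add: lift_apply[OF f])
      qed
      then show "\<exists>T. open T \<and> w0 \<in> T \<and> Ck_on k T (\<lambda>w. lift A V (fst w, inv_into U \<phi> (snd w)) f)"
        using O T(2) p(2) by (intro exI[of _ "UNIV \<times> T"]) (auto simp: mem_Times_iff)
    qed
  qed
qed

section \<open>Lie brackets of the time field and the lifts\<close>

lemma lift_not_smooth: "\<not> smooth_fun spacetime f \<Longrightarrow> lift A V p f = 0"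
  by (simp add: lift_def tvec_pair_def)

lemma time_field_not_smooth: "\<not> smooth_fun spacetime f \<Longrightarrow> time_field A p f = 0"
  by (simp add: time_field_def tvec_pair_def)

lemma lie_bracket_lift:
  assumes V: "V \<in> vector_fields A" and W: "W \<in> vector_fields A"
  shows "lie_bracket (lift A V) (lift A W) = lift A (lie_bracket V W)"
proof (intro ext)
  fix p :: "real \<times> 'a" and f :: "real \<times> 'a \<Rightarrow> real"
  obtain t x where p: "p = (t, x)" by fastforce
  show "lie_bracket (lift A V) (lift A W) p f = lift A (lie_bracket V W) p f"
  proof (cases "smooth_fun spacetime f")
    case True
    then have "smooth_fun spacetime (\<lambda>q. lift A V q f)" "smooth_fun spacetime (\<lambda>q. lift A W q f)"
      using V W by (auto intro: vector_field_smooth lift_vector_field)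
    with True show ?thesis by (simp add: p lie_bracket_def lift_apply)
  next
    \<comment> \<open>The inner functions are constantly 0 here, and tangent vectors annihilate
      constants.\<close>
    case False
    then show ?thesis
      using tangent_vector_const[OF vector_field_in_tangent_space[OF lift_vector_field]] V W
      by (simp add: lie_bracket_def lift_not_smooth)
  qed
qed

text \<open>In a product chart the bracket compares the derivatives along (1, 0) and (0, e) in the
  two orders. The outer time derivative keeps x fixed, and V does not depend on t, so its component
  vector \<open>e\<close> at the single point x suffices for both orders.\<close>

lemma lie_bracket_lift_time:
  assumes V: "V \<in> vector_fields A"
  shows "lie_bracket (lift A V) (time_field A) = 0"
proof (intro ext)
  fix p :: "real \<times> 'a" and f :: "real \<times> 'a \<Rightarrow> real"
  obtain t x where p: "p = (t, x)" by fastforce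
  show "lie_bracket (lift A V) (time_field A) p f = 0 p f"
  proof (cases "smooth_fun spacetime f")
    case f: True
    obtain U \<phi> where U: "(U, \<phi>) \<in> A" "x \<in> U" by (rule chart_at)
    obtain e where e: "V x = chart_vector A U \<phi> x e"
      using vector_field_in_tangent_space[OF V, of x] tangent_space_chart[OF U] by auto
    let ?F = "\<lambda>w. f (fst w, inv_into U \<phi> (snd w))"
    have F: "Ck_on 2 (UNIV \<times> \<phi> ` U) ?F" by (rule smooth_fun_spacetimeD[OF f U(1)])
    have w: "(t, \<phi> x) \<in> UNIV \<times> \<phi> ` U" using U(2) by simp
    have Tf: "smooth_fun spacetime (\<lambda>q. time_field A q f)" and Vf: "smooth_fun spacetime (\<lambda>q. lift A V q f)"
      using f V by (auto intro: vector_field_smooth lift_vector_field time_field_vector_field)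
    have "lift A V (t, x) (\<lambda>q. time_field A q f)
        = frechet_derivative (\<lambda>w. time_field A (fst w, inv_into U \<phi> (snd w)) f) (at (t, \<phi> x)) (0, e)"
      using spacetime_partials(3)[OF Tf U, of e t] by (simp add: lift_apply[OF Tf] e)
    also have "\<dots> = frechet_derivative (\<lambda>w. frechet_derivative ?F (at w) (1, 0)) (at (t, \<phi> x)) (0, e)"
    proof -
      have "time_field A (fst w, inv_into U \<phi> (snd w)) f = frechet_derivative ?F (at w) (1, 0)"
        if "w \<in> UNIV \<times> \<phi> ` U" for w
        using that spacetime_partials(2)[OF f U(1)] inv_chart[OF U(1)] by (auto simp: time_field_apply f)
      from frechet_derivative_cong_open[OF open_spacetime_range[OF U(1)] w this] show ?thesis by simp
    qed
    also have "\<dots> = frechet_derivative (\<lambda>w. frechet_derivative ?F (at w) (0, e)) (at (t, \<phi> x)) (1, 0)"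
      by (rule frechet_derivative_symmetric[OF open_spacetime_range[OF U(1)] w F])
    also have "\<dots> = deriv (\<lambda>s. frechet_derivative ?F (at (s, \<phi> x)) (0, e)) t"
      using F w by (intro DERIV_imp_deriv[symmetric] has_derivative_partials(1)) (auto simp: numeral_2_eq_2)
    also have "\<dots> = time_field A (t, x) (\<lambda>q. lift A V q f)"
      using spacetime_partials(3)[OF f U, of e] by (simp add: time_field_apply[OF Vf] lift_apply[OF f] e)
    finally show ?thesis by (simp add: p lie_bracket_def)
  next
    case False
    then show ?thesis
      using tangent_vector_const[OF vector_field_in_tangent_space[OF lift_vector_field[OF V]]]
        tangent_vector_const[OF vector_field_in_tangent_space[OF time_field_vector_field]]
      by (simp add: lie_bracket_def lift_not_smooth time_field_not_smooth)
  qed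
qed

lemma lie_bracket_time_lift:
  assumes "V \<in> vector_fields A"
  shows "lie_bracket (time_field A) (lift A V) = 0"
  using lie_bracket_lift_time[OF assms] by (simp add: lie_bracket_def fun_eq_iff)

lemma lift_apply_snd: "smooth_fun A h \<Longrightarrow> lift A V p (\<lambda>q. h (snd q)) = V (snd p) h"
  by (cases p) (simp add: lift_apply smooth_fun_snd)

lemma time_field_apply_snd: "smooth_fun A h \<Longrightarrow> time_field A p (\<lambda>q. h (snd q)) = 0"
  by (cases p) (simp add: time_field_apply smooth_fun_snd)

end

section \<open>Metrics\<close>

locale riemannian_manifold = smooth_manifold A
  for A :: "('a::{t2_space, second_countable_topology}, 'e::euclidean_space) atlas" +
  fixes g :: "'a metric"
  assumes metric: "riemannian_metric A g"
begin

lemma metric_linear: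
  assumes "u \<in> tangent_space A p" "v \<in> tangent_space A p" "w \<in> tangent_space A p"
  shows "g p (u + v) w = g p u w + g p v w" "g p (c *\<^sub>T u) w = c * g p u w"
proof -
  have "\<forall>p. \<forall>u\<in>tangent_space A p. \<forall>v\<in>tangent_space A p. \<forall>w\<in>tangent_space A p. \<forall>c.
      g p (u + v) w = g p u w + g p v w \<and> g p (c *\<^sub>T u) w = c * g p u w"
    using metric unfolding riemannian_metric_def by (elim conjE)
  with assms show "g p (u + v) w = g p u w + g p v w" "g p (c *\<^sub>T u) w = c * g p u w" by simp_all
qed

lemmas metric_add_left = metric_linear(1)

lemma metric_scale_left:
  "u \<in> tangent_space A p \<Longrightarrow> w \<in> tangent_space A p \<Longrightarrow> g p (c *\<^sub>T u) w = c * g p u w"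
  by (rule metric_linear(2))

lemma metric_sym:
  assumes "u \<in> tangent_space A p" "v \<in> tangent_space A p"
  shows "g p u v = g p v u"
proof -
  have "\<forall>p. \<forall>u\<in>tangent_space A p. \<forall>v\<in>tangent_space A p. g p u v = g p v u"
    using metric unfolding riemannian_metric_def by (elim conjE)
  with assms show ?thesis by blast
qed

lemma metric_pos:
  assumes "u \<in> tangent_space A p" "u \<noteq> 0"
  shows "g p u u > 0"
proof -
  have "\<forall>p. \<forall>u\<in>tangent_space A p. u \<noteq> 0 \<longrightarrow> g p u u > 0"
    using metric unfolding riemannian_metric_def by (elim conjE)
  with assms show ?thesis by blast
qed

lemma metric_smooth:
  assumes "X \<in> vector_fields A" "Y \<in> vector_fields A"
  shows "smooth_fun A (\<lambda>p. g p (X p) (Y p))"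
proof -
  have "\<forall>X\<in>vector_fields A. \<forall>Y\<in>vector_fields A. smooth_fun A (\<lambda>p. g p (X p) (Y p))"
    using metric unfolding riemannian_metric_def by (elim conjE)
  with assms show ?thesis by blast
qed

lemma metric_diff_left:
  assumes "u \<in> tangent_space A p" "v \<in> tangent_space A p" "w \<in> tangent_space A p"
  shows "g p (u - v) w = g p u w - g p v w"
  using metric_add_left[of "u - v" p v w] assms tangent_space_diff by simp

lemma
  assumes "u \<in> tangent_space A p" "v \<in> tangent_space A p" "w \<in> tangent_space A p"
  shows metric_add_right: "g p u (v + w) = g p u v + g p u w"
    and metric_diff_right: "g p u (v - w) = g p u v - g p u w"
  using assms metric_sym[of u] metric_add_left[of v p w u] metric_diff_left[of v p w u]
  by (simp_all add: tangent_space_add tangent_space_diff)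

lemma metric_scale_right:
  "u \<in> tangent_space A p \<Longrightarrow> v \<in> tangent_space A p \<Longrightarrow> g p u (c *\<^sub>T v) = c * g p u v"
  by (simp add: metric_sym[of u] tangent_space_scale metric_scale_left)

lemma metric_zero: "u \<in> tangent_space A p \<Longrightarrow> g p u 0 = 0"
  using metric_diff_right[of u p u u] by simp

lemmas metric_simps =
  metric_add_left metric_scale_left metric_diff_left
  metric_add_right metric_scale_right metric_diff_right
  tangent_space_add tangent_space_diff tangent_space_scale

text \<open>Definiteness requires u - v itself as test vector; it is supplied as the value at p of a
  global vector field.\<close>

lemma metric_cancel:
  assumes "u \<in> tangent_space A p" "v \<in> tangent_space A p"
    and "\<And>Y. Y \<in> vector_fields A \<Longrightarrow> g p u (Y p) = g p v (Y p)"
  shows "u = v"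
proof (rule ccontr)
  assume "u \<noteq> v"
  then have "g p (u - v) (u - v) > 0"
    using assms by (intro metric_pos tangent_space_diff) auto
  moreover obtain Y where "Y \<in> vector_fields A" "Y p = u - v"
    using vector_field_extending[OF tangent_space_diff[OF assms(1,2)]] .
  ultimately show False
    using assms(3)[of Y] assms(1,2) by (simp add: metric_diff_left tangent_space_diff)
qed

text \<open>\<open>sharp\<close> is a definite description, hence meaningful only with existence and
  uniqueness. Uniqueness is \<open>metric_cancel\<close>; a candidate vector has to be brought
  along.\<close>

lemma sharp_eq:
  assumes v: "v \<in> tangent_space A p" and "\<And>Y. Y \<in> vector_fields A \<Longrightarrow> g p v (Y p) = \<omega> Y p"
  shows "sharp A g \<omega> p = v"
proof -
  have sym: "g p (Y p) u = g p u (Y p)" if "Y \<in> vector_fields A" "u \<in> tangent_space A p" for Y u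
    using that by (simp add: metric_sym[of u] vector_field_in_tangent_space)
  show ?thesis
    unfolding sharp_def
  proof (rule the_equality)
    show "v \<in> tangent_space A p \<and> (\<forall>Y\<in>vector_fields A. g p (Y p) v = \<omega> Y p)"
      using assms by (simp add: sym)
    fix u assume u: "u \<in> tangent_space A p \<and> (\<forall>Y\<in>vector_fields A. g p (Y p) u = \<omega> Y p)"
    then show "u = v"
      using assms by (intro metric_cancel[OF _ v]) (auto simp flip: sym)
  qed
qed

end

section \<open>The stationary metric and its nondegeneracy\<close>

locale stationary_spacetime = riemannian_manifold A g
  for A :: "('a::{t2_space, second_countable_topology}, 'e::euclidean_space) atlas" and g :: "'a metric" +
  fixes \<beta> :: "'a \<Rightarrow> real" and \<delta> :: "'a vfield"
    and nablaR :: "'a vfield \<Rightarrow> 'a vfield \<Rightarrow> 'a vfield"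
    and nabla :: "(real \<times> 'a) vfield \<Rightarrow> (real \<times> 'a) vfield \<Rightarrow> (real \<times> 'a) vfield"
  assumes \<beta>_smooth: "smooth_fun A \<beta>" and \<beta>_pos: "\<beta> x > 0"
    and \<delta>: "\<delta> \<in> vector_fields A"
    and lcR: "levi_civita A g nablaR"
    and lc: "levi_civita (spacetime_atlas A) (stationary_metric g \<beta> \<delta>) nabla"
begin

abbreviation G :: "(real \<times> 'a) metric" where
  "G \<equiv> stationary_metric g \<beta> \<delta>"

lemma tangent_\<delta>: "\<delta> x \<in> tangent_space A x"
  using \<delta> by (rule vector_field_in_tangent_space)

lemma G_tvec_pair:
  assumes "v \<in> tangent_space A x" "w \<in> tangent_space A x"
  shows "G (t, x) (tvec_pair A (t, x) \<tau> v) (tvec_pair A (t, x) \<sigma> w)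
    = - \<beta> x * \<tau> * \<sigma> + g x v w + g x (\<delta> x) v * \<sigma> + g x (\<delta> x) w * \<tau>"
  using assms by (simp add: stationary_metric_def d_time_tvec_pair d_space_tvec_pair)

lemma G_sym:
  "u \<in> tangent_space spacetime p \<Longrightarrow> v \<in> tangent_space spacetime p \<Longrightarrow> G p u v = G p v u"
  by (cases p) (auto simp: tangent_space_spacetime G_tvec_pair metric_sym)

lemma G_diff:
  "\<lbrakk>u \<in> tangent_space spacetime p; v \<in> tangent_space spacetime p; w \<in> tangent_space spacetime p\<rbrakk>
    \<Longrightarrow> G p (u - v) w = G p u w - G p v w"
  by (cases p) (auto simp: tangent_space_spacetime tvec_pair_diff G_tvec_pair metric_simps
      tangent_\<delta> algebra_simps)

lemma G_time_time: "G p (time_field A p) (time_field A p) = - \<beta> (snd p)"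
  by (cases p) (simp add: time_field_def G_tvec_pair tangent_space_zero metric_zero tangent_\<delta>)

lemma G_time_lift:
  "V \<in> vector_fields A \<Longrightarrow> G p (time_field A p) (lift A V p) = g (snd p) (\<delta> (snd p)) (V (snd p))"
  by (cases p)
     (simp add: time_field_def lift_def G_tvec_pair tangent_space_zero metric_zero tangent_\<delta>
       vector_field_in_tangent_space metric_sym[of 0])

lemma G_lift_time:
  "V \<in> vector_fields A \<Longrightarrow> G p (lift A V p) (time_field A p) = g (snd p) (\<delta> (snd p)) (V (snd p))"
  using G_time_lift[of V p] G_sym[of "lift A V p" p "time_field A p"]
  by (simp add: vector_field_in_tangent_space lift_vector_field time_field_vector_field)

lemma G_lift_lift:
  "\<lbrakk>V \<in> vector_fields A; W \<in> vector_fields A\<rbrakk>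
    \<Longrightarrow> G p (lift A V p) (lift A W p) = g (snd p) (V (snd p)) (W (snd p))"
  by (cases p) (simp add: lift_def G_tvec_pair vector_field_in_tangent_space)

lemma nablaR_vector_field:
  assumes "X \<in> vector_fields A" "Y \<in> vector_fields A"
  shows "nablaR X Y \<in> vector_fields A"
proof -
  have "\<forall>X\<in>vector_fields A. \<forall>Y\<in>vector_fields A. nablaR X Y \<in> vector_fields A"
    using lcR unfolding levi_civita_def affine_connection_def by (elim conjE)
  with assms show ?thesis by blast
qed

lemma nabla_vector_field:
  assumes "X \<in> vector_fields spacetime" "Y \<in> vector_fields spacetime"
  shows "nabla X Y \<in> vector_fields spacetime"
proof -
  have "\<forall>X\<in>vector_fields spacetime. \<forall>Y\<in>vector_fields spacetime. nabla X Y \<in> vector_fields spacetime"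
    using lc unfolding levi_civita_def affine_connection_def by (elim conjE)
  with assms show ?thesis by blast
qed

lemma torsionR:
  assumes "X \<in> vector_fields A" "Y \<in> vector_fields A"
  shows "lie_bracket X Y = nablaR X Y - nablaR Y X"
proof -
  have "\<forall>X\<in>vector_fields A. \<forall>Y\<in>vector_fields A. nablaR X Y - nablaR Y X = lie_bracket X Y"
    using lcR unfolding levi_civita_def by (elim conjE)
  with assms show ?thesis by simp
qed

lemma torsion:
  assumes "X \<in> vector_fields spacetime" "Y \<in> vector_fields spacetime"
  shows "nabla X Y - nabla Y X = lie_bracket X Y"
proof -
  have "\<forall>X\<in>vector_fields spacetime. \<forall>Y\<in>vector_fields spacetime. nabla X Y - nabla Y X = lie_bracket X Y"
    using lc unfolding levi_civita_def by (elim conjE)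
  with assms show ?thesis by simp
qed

lemma compatR:
  assumes "X \<in> vector_fields A" "Y \<in> vector_fields A" "Z \<in> vector_fields A"
  shows "X p (\<lambda>q. g q (Y q) (Z q)) = g p (nablaR X Y p) (Z p) + g p (Y p) (nablaR X Z p)"
proof -
  have "\<forall>X\<in>vector_fields A. \<forall>Y\<in>vector_fields A. \<forall>Z\<in>vector_fields A. \<forall>p.
      X p (\<lambda>q. g q (Y q) (Z q)) = g p (nablaR X Y p) (Z p) + g p (Y p) (nablaR X Z p)"
    using lcR unfolding levi_civita_def by (elim conjE)
  with assms show ?thesis by blast
qed

lemma koszul:
  assumes "X \<in> vector_fields spacetime" "Y \<in> vector_fields spacetime" "Z \<in> vector_fields spacetime"
  shows "2 * G p (nabla X Y p) (Z p) =
      X p (\<lambda>q. G q (Y q) (Z q)) + Y p (\<lambda>q. G q (X q) (Z q)) - Z p (\<lambda>q. G q (X q) (Y q))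
      + G p (lie_bracket X Y p) (Z p) - G p (lie_bracket X Z p) (Y p) - G p (lie_bracket Y Z p) (X p)"
  by (rule koszul_formula[OF lc assms]) (auto intro: G_sym G_diff)

lemma denominator_pos: "\<beta> x + g x (\<delta> x) (\<delta> x) > 0"
  using \<beta>_pos[of x] metric_pos[OF tangent_\<delta>, of x] metric_zero[OF tangent_\<delta>, of x]
  by (cases "\<delta> x = 0") (auto intro: add_pos_pos)

text \<open>Nondegeneracy in the form used for all three formulas: the right-hand sides in
  \<open>T\<close> and \<open>L\<close> are the products of the vector (a, v) with the time field
  and with a lift, written out.\<close>

lemma G_cancel:
  assumes u: "u \<in> tangent_space spacetime (t, x)" and v: "v \<in> tangent_space A x"
    and T: "G (t, x) u (time_field A (t, x)) = - \<beta> x * a + g x (\<delta> x) v"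
    and L: "\<And>Y. Y \<in> vector_fields A \<Longrightarrow>
      G (t, x) u (lift A Y (t, x)) = g x v (Y x) + a * g x (\<delta> x) (Y x)"
  shows "u = tvec_pair A (t, x) a v"
proof -
  obtain \<tau> w where u_def: "u = tvec_pair A (t, x) \<tau> w" and w: "w \<in> tangent_space A x"
    using u by (auto simp: tangent_space_spacetime)
  note [simp] = tangent_\<delta> v w
  have eq: "w + \<tau> *\<^sub>T \<delta> x = v + a *\<^sub>T \<delta> x"
  proof (rule metric_cancel)
    fix Y assume Y: "Y \<in> vector_fields A"
    then show "g x (w + \<tau> *\<^sub>T \<delta> x) (Y x) = g x (v + a *\<^sub>T \<delta> x) (Y x)"
      using L[OF Y] vector_field_in_tangent_space[OF Y, of x]
      by (simp add: u_def lift_def G_tvec_pair metric_simps algebra_simps)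
  qed (simp_all add: tangent_space_add tangent_space_scale)
  \<comment> \<open>Pairing \<open>eq\<close> with \<delta> eliminates the unknown product of
    \<delta> and w from this equation and leaves \<tau> - a times a positive number.\<close>
  have "- \<beta> x * \<tau> + g x (\<delta> x) w = - \<beta> x * a + g x (\<delta> x) v"
    using T by (simp add: u_def time_field_def G_tvec_pair tangent_space_zero metric_zero)
  moreover have "g x (\<delta> x) w + \<tau> * g x (\<delta> x) (\<delta> x) = g x (\<delta> x) v + a * g x (\<delta> x) (\<delta> x)"
    using arg_cong[OF eq, of "g x (\<delta> x)"] by (simp add: metric_simps)
  ultimately have "(\<tau> - a) * (\<beta> x + g x (\<delta> x) (\<delta> x)) = 0" by (simp add: algebra_simps)
  then have "\<tau> = a" using denominator_pos[of x] by simp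
  with eq show ?thesis by (simp add: u_def)
qed

section \<open>The three covariant derivatives\<close>

lemma tangent_nabla:
  "\<lbrakk>X \<in> vector_fields spacetime; Y \<in> vector_fields spacetime\<rbrakk>
    \<Longrightarrow> nabla X Y p \<in> tangent_space spacetime p"
  by (intro vector_field_in_tangent_space nabla_vector_field)

lemma tangent_nablaR:
  "\<lbrakk>X \<in> vector_fields A; Y \<in> vector_fields A\<rbrakk> \<Longrightarrow> nablaR X Y p \<in> tangent_space A p"
  by (intro vector_field_in_tangent_space nablaR_vector_field)

section \<open>Products of the covariant derivatives with the time field and the lifts\<close>

lemma minus_\<beta>_smooth: "smooth_fun A (\<lambda>x. - \<beta> x)"
  using tangent_vector_uminus(2)[OF tangent_space_zero \<beta>_smooth] .

lemma lift_minus_\<beta>: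
  "V \<in> vector_fields A \<Longrightarrow> lift A V p (\<lambda>q. - \<beta> (snd q)) = - V (snd p) \<beta>"
  using lift_apply_snd[OF minus_\<beta>_smooth]
    tangent_vector_uminus(1)[OF vector_field_in_tangent_space \<beta>_smooth] by simp

lemma time_minus_\<beta>: "time_field A p (\<lambda>q. - \<beta> (snd q)) = 0"
  by (rule time_field_apply_snd[OF minus_\<beta>_smooth])

lemma lift_metric:
  assumes "V \<in> vector_fields A" "X \<in> vector_fields A" "Y \<in> vector_fields A"
  shows "lift A V p (\<lambda>q. g (snd q) (X (snd q)) (Y (snd q)))
      = g (snd p) (nablaR V X (snd p)) (Y (snd p)) + g (snd p) (X (snd p)) (nablaR V Y (snd p))"
  using lift_apply_snd[OF metric_smooth[OF assms(2,3)]] compatR[OF assms] by simp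

lemma time_metric:
  "X \<in> vector_fields A \<Longrightarrow> Y \<in> vector_fields A \<Longrightarrow>
    time_field A p (\<lambda>q. g (snd q) (X (snd q)) (Y (snd q))) = 0"
  by (rule time_field_apply_snd[OF metric_smooth])

lemma tangent_lie_bracket:
  "X \<in> vector_fields A \<Longrightarrow> Y \<in> vector_fields A \<Longrightarrow> lie_bracket X Y p \<in> tangent_space A p"
  by (simp add: torsionR tangent_space_diff tangent_nablaR)

text \<open>\<open>G_lift_lift\<close> expects members of \<open>vector_fields\<close>. For a
  bracket, pointwise tangency is at hand through torsion-freeness of \<open>nablaR\<close>, and the
  product needs no more than that.\<close>

lemma G_bracket_lift:
  assumes "X \<in> vector_fields A" "Y \<in> vector_fields A" "Z \<in> vector_fields A"
  shows "G p (lift A (lie_bracket X Y) p) (lift A Z p) = g (snd p) (lie_bracket X Y (snd p)) (Z (snd p))"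
  using assms
  by (cases p) (simp add: lift_def G_tvec_pair tangent_lie_bracket vector_field_in_tangent_space)

lemma G_bracket_time:
  assumes "X \<in> vector_fields A" "Y \<in> vector_fields A"
  shows "G p (lift A (lie_bracket X Y) p) (time_field A p)
    = g (snd p) (\<delta> (snd p)) (nablaR X Y (snd p)) - g (snd p) (\<delta> (snd p)) (nablaR Y X (snd p))"
  using assms
  by (cases p) (simp add: lift_def time_field_def G_tvec_pair torsionR tangent_space_diff tangent_nablaR
      tangent_\<delta> tangent_space_zero metric_zero metric_diff_right)

lemma G_zero: "v \<in> tangent_space spacetime p \<Longrightarrow> G p 0 v = 0"
  using G_diff[of v p v v] by simp

text \<open>The brackets vanish, and so do time derivatives of the products, which depend on x only.
  The one surviving Koszul term differentiates the square -\<beta> of the time field along Y, with a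
  minus sign.\<close>

lemma time_time_components:
  shows "G p (nabla (time_field A) (time_field A) p) (time_field A p) = 0"
    and "Y \<in> vector_fields A \<Longrightarrow>
      2 * G p (nabla (time_field A) (time_field A) p) (lift A Y p) = Y (snd p) \<beta>"
proof -
  note T = time_field_vector_field
  show "G p (nabla (time_field A) (time_field A) p) (time_field A p) = 0"
    using koszul[OF T T T, of p] time_minus_\<beta>[of p]
    by (simp add: G_time_time lie_bracket_self G_zero vector_field_in_tangent_space T)
  assume Y: "Y \<in> vector_fields A"
  show "2 * G p (nabla (time_field A) (time_field A) p) (lift A Y p) = Y (snd p) \<beta>"
    using koszul[OF T T lift_vector_field[OF Y], of p]
    by (simp add: G_time_time G_time_lift Y lift_minus_\<beta> time_minus_\<beta> lift_metric time_metric \<delta> lie_bracket_self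
        lie_bracket_time_lift G_zero vector_field_in_tangent_space T lift_vector_field)
qed

text \<open>Against a lift the Koszul formula leaves V<\<delta>, Y> - Y<\<delta>, V> - <\<delta>,
  [V, Y]>, the exterior derivative of the 1-form dual to \<delta>. Compatibility and
  torsion-freeness of \<open>nablaR\<close> turn it into the antisymmetrised covariant derivative of
  \<delta>.\<close>

lemma lift_time_components:
  assumes V: "V \<in> vector_fields A"
  shows "2 * G p (nabla (lift A V) (time_field A) p) (time_field A p) = - V (snd p) \<beta>"
    and "Y \<in> vector_fields A \<Longrightarrow>
      2 * G p (nabla (lift A V) (time_field A) p) (lift A Y p)
        = g (snd p) (nablaR V \<delta> (snd p)) (Y (snd p)) - g (snd p) (nablaR Y \<delta> (snd p)) (V (snd p))"
proof -
  note T = time_field_vector_field and LV = lift_vector_field[OF V]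
  show "2 * G p (nabla (lift A V) (time_field A) p) (time_field A p) = - V (snd p) \<beta>"
    using koszul[OF LV T T, of p]
    by (simp add: G_time_time G_lift_time V lift_minus_\<beta> time_minus_\<beta> lift_metric time_metric \<delta> lie_bracket_self
        lie_bracket_lift_time G_zero vector_field_in_tangent_space T LV)
  assume Y: "Y \<in> vector_fields A"
  note LY = lift_vector_field[OF Y]
  obtain t x where p: "p = (t, x)" by fastforce
  show "2 * G p (nabla (lift A V) (time_field A) p) (lift A Y p)
        = g (snd p) (nablaR V \<delta> (snd p)) (Y (snd p)) - g (snd p) (nablaR Y \<delta> (snd p)) (V (snd p))"
    using koszul[OF LV T LY, of p]
    by (simp add: p G_lift_time G_time_lift G_lift_lift G_bracket_time lie_bracket_lift V Y \<delta> lift_metric time_metric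
        lie_bracket_lift_time lie_bracket_time_lift G_zero vector_field_in_tangent_space T LV LY)
qed

text \<open>Against the time field the symmetrised covariant derivative of \<delta> appears, which
  is the Lie derivative of the Riemannian metric along \<delta>. Half of it measures how far the
  derivative of lifts leaves the slices.\<close>

lemma lift_lift_components:
  assumes V: "V \<in> vector_fields A" and W: "W \<in> vector_fields A"
  shows "2 * G p (nabla (lift A V) (lift A W) p) (time_field A p)
      = 2 * g (snd p) (\<delta> (snd p)) (nablaR V W (snd p))
        + g (snd p) (W (snd p)) (nablaR V \<delta> (snd p)) + g (snd p) (V (snd p)) (nablaR W \<delta> (snd p))"
    and "Y \<in> vector_fields A \<Longrightarrow>
      G p (nabla (lift A V) (lift A W) p) (lift A Y p) = g (snd p) (nablaR V W (snd p)) (Y (snd p))"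
proof -
  note T = time_field_vector_field and LV = lift_vector_field[OF V] and LW = lift_vector_field[OF W]
  obtain t x where p: "p = (t, x)" by fastforce
  note tan = tangent_\<delta>[of x] V[THEN vector_field_in_tangent_space, of x] W[THEN vector_field_in_tangent_space, of x]
    tangent_nablaR[OF V W, of x] tangent_nablaR[OF W V, of x] tangent_nablaR[OF V \<delta>, of x] tangent_nablaR[OF W \<delta>, of x]
  show "2 * G p (nabla (lift A V) (lift A W) p) (time_field A p)
      = 2 * g (snd p) (\<delta> (snd p)) (nablaR V W (snd p))
        + g (snd p) (W (snd p)) (nablaR V \<delta> (snd p)) + g (snd p) (V (snd p)) (nablaR W \<delta> (snd p))"
    using koszul[OF LV LW T, of p] tan
      metric_sym[of "nablaR V \<delta> x" x "W x"] metric_sym[of "nablaR W \<delta> x" x "V x"]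
    by (simp add: p G_lift_time G_time_lift G_lift_lift G_bracket_time lie_bracket_lift V W \<delta> lift_metric time_metric
        lie_bracket_lift_time lie_bracket_time_lift G_zero vector_field_in_tangent_space T LV LW)
  assume Y: "Y \<in> vector_fields A"
  note LY = lift_vector_field[OF Y]
  \<comment> \<open>Lifts reproduce every term of the Koszul formula of the base, so comparing the
    two formulas gives the product without expanding either.\<close>
  have "2 * g x (nablaR V W x) (Y x) =
      V x (\<lambda>q. g q (W q) (Y q)) + W x (\<lambda>q. g q (V q) (Y q)) - Y x (\<lambda>q. g q (V q) (W q))
      + g x (lie_bracket V W x) (Y x) - g x (lie_bracket V Y x) (W x) - g x (lie_bracket W Y x) (V x)"
    by (rule koszul_formula[OF lcR V W Y]) (auto intro: metric_sym metric_diff_left)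
  then show "G p (nabla (lift A V) (lift A W) p) (lift A Y p) = g (snd p) (nablaR V W (snd p)) (Y (snd p))"
    using koszul[OF LV LW LY, of p]
    by (simp add: p G_lift_lift V W Y lie_bracket_lift G_bracket_lift
        lift_apply_snd[OF metric_smooth])
qed

end

section \<open>Existence of the gradient and of the dual field\<close>

context stationary_spacetime
begin

text \<open>Taking products of u with lifts only gives a 1-form on the base that comes with its
  representing vector, \<open>w + \<tau> *\<^sub>T \<delta> x\<close>. Applied to values of
  \<open>nabla\<close> it produces the candidates for \<open>sharp_eq\<close>.\<close>

lemma represent_on_lifts:
  assumes "u \<in> tangent_space spacetime (t, x)"
  obtains v where "v \<in> tangent_space A x"
    "\<And>Y. Y \<in> vector_fields A \<Longrightarrow> G (t, x) u (lift A Y (t, x)) = g x v (Y x)"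
proof -
  obtain \<tau> w where u: "u = tvec_pair A (t, x) \<tau> w" and w: "w \<in> tangent_space A x"
    using assms by (auto simp: tangent_space_spacetime)
  show ?thesis
  proof (rule that[of "w + \<tau> *\<^sub>T \<delta> x"])
    fix Y assume "Y \<in> vector_fields A"
    from vector_field_in_tangent_space[OF this, of x]
    show "G (t, x) u (lift A Y (t, x)) = g x (w + \<tau> *\<^sub>T \<delta> x) (Y x)"
      by (simp add: u lift_def G_tvec_pair w tangent_\<delta> metric_simps)
  qed (simp add: w tangent_\<delta> tangent_space_add tangent_space_scale)
qed

text \<open>
  Existence of the gradient and of the field dual to \<open>Y \<mapsto> \<langle>\<nabla>\<^sub>Y \<delta>, V\<rangle>\<close> needs no Riesz argument: the values of
  the given connection \<open>nabla\<close> already represent these 1-forms.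
\<close>

lemma
  shows tangent_gradient: "gradient A g \<beta> x \<in> tangent_space A x"
    and metric_gradient: "Y \<in> vector_fields A \<Longrightarrow> g x (gradient A g \<beta> x) (Y x) = Y x \<beta>"
proof -
  note T = time_field_vector_field
  obtain v where v: "v \<in> tangent_space A x" and
    eq: "\<And>Y. Y \<in> vector_fields A \<Longrightarrow>
      G (0, x) (nabla (time_field A) (time_field A) (0, x)) (lift A Y (0, x)) = g x v (Y x)"
    by (rule represent_on_lifts[OF tangent_nabla[OF T T]]) blast
  \<comment> \<open>The product of the derivative with a lift is half of Y(\<beta>), hence the
    factor 2. The base time 0 is arbitrary, since these products depend on x only.\<close>
  have dual: "g x (2 *\<^sub>T v) (Y x) = Y x \<beta>" if "Y \<in> vector_fields A" for Y
    using eq[OF that] time_time_components(2)[OF that, of "(0, x)"]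
      vector_field_in_tangent_space[OF that, of x]
    by (simp add: metric_scale_left v)
  have "gradient A g \<beta> x = 2 *\<^sub>T v"
    unfolding gradient_def by (rule sharp_eq) (simp_all add: tangent_space_scale v dual)
  then show "gradient A g \<beta> x \<in> tangent_space A x"
    and "Y \<in> vector_fields A \<Longrightarrow> g x (gradient A g \<beta> x) (Y x) = Y x \<beta>"
    using dual tangent_space_scale[OF v] by simp_all
qed

lemma
  assumes V: "V \<in> vector_fields A"
  defines "s \<equiv> sharp A g (\<lambda>Y y. g y (nablaR Y \<delta> y) (V y))"
  shows tangent_sharp: "s x \<in> tangent_space A x"
    and metric_sharp: "Y \<in> vector_fields A \<Longrightarrow> g x (s x) (Y x) = g x (nablaR Y \<delta> x) (V x)"
proof -
  obtain v where v: "v \<in> tangent_space A x" and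
    eq: "\<And>Y. Y \<in> vector_fields A \<Longrightarrow>
      G (0, x) (nabla (lift A V) (time_field A) (0, x)) (lift A Y (0, x)) = g x v (Y x)"
    by (rule represent_on_lifts[OF tangent_nabla[OF lift_vector_field[OF V] time_field_vector_field]]) blast
  \<comment> \<open>Twice v represents the 1-form <\<nabla>_V \<delta>, Y> - <\<nabla>_Y \<delta>,
    V>, so subtracting it from \<open>nablaR V \<delta> x\<close> isolates the second term.\<close>
  have tan: "nablaR V \<delta> x - 2 *\<^sub>T v \<in> tangent_space A x"
    by (intro tangent_space_diff tangent_space_scale tangent_nablaR V \<delta> v)
  have dual: "g x (nablaR V \<delta> x - 2 *\<^sub>T v) (Y x) = g x (nablaR Y \<delta> x) (V x)" if "Y \<in> vector_fields A" for Y
    using eq[OF that] lift_time_components(2)[OF V that, of "(0, x)"]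
      vector_field_in_tangent_space[OF that, of x]
    by (simp add: metric_diff_left metric_scale_left v tangent_space_scale tangent_nablaR V \<delta>)
  have "s x = nablaR V \<delta> x - 2 *\<^sub>T v"
    unfolding s_def by (rule sharp_eq) (simp_all add: tan dual)
  then show "s x \<in> tangent_space A x"
    and "Y \<in> vector_fields A \<Longrightarrow> g x (s x) (Y x) = g x (nablaR Y \<delta> x) (V x)"
    using dual tan by simp_all
qed

section \<open>Solving for the covariant derivatives\<close>

lemma \<Lambda>_eq:
  assumes "\<Lambda> = - 1 / (\<beta> x + g x (\<delta> x) (\<delta> x))"
  shows "\<Lambda> * (\<beta> x + g x (\<delta> x) (\<delta> x)) = - 1"
  using denominator_pos[of x] assms by simp

text \<open>Lifts see only v + a \<delta>, and since the multiple of \<delta> in v is opposite to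
  the time coefficient a, \<Lambda> drops out of these products. It is the product with the time
  field that fixes \<Lambda>. The same pattern settles the other two derivatives.\<close>

lemma nabla_time_time:
  assumes "\<Lambda> = - 1 / (\<beta> x + g x (\<delta> x) (\<delta> x))"
  shows "nabla (time_field A) (time_field A) (t, x) =
        (- 1/2 * \<Lambda> * g x (\<delta> x) (gradient A g \<beta> x)) *\<^sub>T time_field A (t, x)
        + (1/2 * \<Lambda> * g x (\<delta> x) (gradient A g \<beta> x)) *\<^sub>T lift A \<delta> (t, x)
        + (1/2) *\<^sub>T lift A (gradient A g \<beta>) (t, x)"
proof -
  note T = time_field_vector_field
  \<comment> \<open>K is \<delta>(\<beta>), and -K/2 is the product of the derivative with the slice
    normal \<open>time_field A - lift A \<delta>\<close>: the time field contributes 0 and the lift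
    of \<delta> contributes half of K.\<close>
  define K where "K = g x (\<delta> x) (gradient A g \<beta> x)"
  define v where "v = (1/2 * \<Lambda> * K) *\<^sub>T \<delta> x + (1/2) *\<^sub>T gradient A g \<beta> x"
  have eq: "nabla (time_field A) (time_field A) (t, x) = tvec_pair A (t, x) (- 1/2 * \<Lambda> * K) v"
  proof (rule G_cancel[OF tangent_nabla[OF T T]])
    show "v \<in> tangent_space A x"
      by (simp add: v_def tangent_\<delta> tangent_gradient tangent_space_add tangent_space_scale)
    have "g x (\<delta> x) v = 1/2 * \<Lambda> * K * g x (\<delta> x) (\<delta> x) + 1/2 * K"
      by (simp add: v_def tangent_\<delta> tangent_gradient metric_simps K_def)
    then have "- \<beta> x * (- 1/2 * \<Lambda> * K) + g x (\<delta> x) v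
        = 1/2 * K * (\<Lambda> * (\<beta> x + g x (\<delta> x) (\<delta> x)) + 1)"
      by (simp add: algebra_simps)
    then show "G (t, x) (nabla (time_field A) (time_field A) (t, x)) (time_field A (t, x))
        = - \<beta> x * (- 1/2 * \<Lambda> * K) + g x (\<delta> x) v"
      by (simp add: time_time_components \<Lambda>_eq[OF assms])
    fix Y assume Y: "Y \<in> vector_fields A"
    show "G (t, x) (nabla (time_field A) (time_field A) (t, x)) (lift A Y (t, x))
        = g x v (Y x) + - 1/2 * \<Lambda> * K * g x (\<delta> x) (Y x)"
      using time_time_components(2)[OF Y, of "(t, x)"] vector_field_in_tangent_space[OF Y, of x]
      by (simp add: v_def tangent_\<delta> tangent_gradient metric_simps metric_gradient Y)
  qed
  \<comment> \<open>The splitting of \<open>tvec_pair\<close> into time and space parts is checked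
    function by function; on functions that are not smooth both sides are 0.\<close>
  show ?thesis
    unfolding eq K_def[symmetric]
    by (auto simp: v_def time_field_def lift_def tvec_pair_def tscale_def fun_eq_iff algebra_simps)
qed

lemma nabla_lift_lift:
  assumes "\<Lambda> = - 1 / (\<beta> x + g x (\<delta> x) (\<delta> x))"
    and V: "V \<in> vector_fields A" and W: "W \<in> vector_fields A"
  shows "nabla (lift A V) (lift A W) (t, x) =
        (1/2 * \<Lambda> * (g x (W x) (nablaR V \<delta> x) + g x (V x) (nablaR W \<delta> x))) *\<^sub>T time_field A (t, x)
        - (1/2 * \<Lambda> * (g x (W x) (nablaR V \<delta> x) + g x (V x) (nablaR W \<delta> x))) *\<^sub>T lift A \<delta> (t, x)
        + lift A (nablaR V W) (t, x)"
proof -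
  \<comment> \<open>K/2 is the product of the derivative with the slice normal: the two products of
    \<delta> with \<open>nablaR V W x\<close> cancel.\<close>
  define K where "K = g x (W x) (nablaR V \<delta> x) + g x (V x) (nablaR W \<delta> x)"
  define v where "v = nablaR V W x - (1/2 * \<Lambda> * K) *\<^sub>T \<delta> x"
  note tan = tangent_\<delta> tangent_nablaR[OF V W]
  have eq: "nabla (lift A V) (lift A W) (t, x) = tvec_pair A (t, x) (1/2 * \<Lambda> * K) v"
  proof (rule G_cancel[OF tangent_nabla[OF V[THEN lift_vector_field] W[THEN lift_vector_field]]])
    show "v \<in> tangent_space A x"
      by (simp add: v_def tan tangent_space_diff tangent_space_scale)
    have "g x (\<delta> x) v = g x (\<delta> x) (nablaR V W x) - 1/2 * \<Lambda> * K * g x (\<delta> x) (\<delta> x)"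
      by (simp add: v_def tan metric_simps)
    then have "- \<beta> x * (1/2 * \<Lambda> * K) + g x (\<delta> x) v
        = g x (\<delta> x) (nablaR V W x) - 1/2 * K * (\<Lambda> * (\<beta> x + g x (\<delta> x) (\<delta> x)))"
      by (simp add: algebra_simps)
    then show "G (t, x) (nabla (lift A V) (lift A W) (t, x)) (time_field A (t, x))
        = - \<beta> x * (1/2 * \<Lambda> * K) + g x (\<delta> x) v"
      using lift_lift_components(1)[OF V W, of "(t, x)"] by (simp add: \<Lambda>_eq[OF assms(1)] K_def field_simps)
    fix Y assume Y: "Y \<in> vector_fields A"
    show "G (t, x) (nabla (lift A V) (lift A W) (t, x)) (lift A Y (t, x))
        = g x v (Y x) + 1/2 * \<Lambda> * K * g x (\<delta> x) (Y x)"
      using lift_lift_components(2)[OF V W Y, of "(t, x)"] vector_field_in_tangent_space[OF Y, of x]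
      by (simp add: v_def tan metric_simps)
  qed
  show ?thesis
    unfolding eq K_def[symmetric]
    by (auto simp: v_def time_field_def lift_def tvec_pair_def tscale_def fun_eq_iff algebra_simps)
qed

lemma nabla_lift_time_commute:
  assumes "V \<in> vector_fields A"
  shows "nabla (lift A V) (time_field A) = nabla (time_field A) (lift A V)"
  using torsion[OF lift_vector_field[OF assms] time_field_vector_field] lie_bracket_lift_time[OF assms]
  by (simp add: fun_eq_iff)

lemma nabla_lift_time:
  assumes "\<Lambda> = - 1 / (\<beta> x + g x (\<delta> x) (\<delta> x))" and V: "V \<in> vector_fields A"
  shows "2 *\<^sub>T nabla (lift A V) (time_field A) (t, x) =
        (- \<Lambda> * (V x \<beta> + g x (\<delta> x) (nablaR V \<delta> x) - g x (nablaR \<delta> \<delta> x) (V x))) *\<^sub>T time_field A (t, x)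
        + (\<Lambda> * (V x \<beta> + g x (\<delta> x) (nablaR V \<delta> x) - g x (nablaR \<delta> \<delta> x) (V x))) *\<^sub>T lift A \<delta> (t, x)
        + lift A (nablaR V \<delta>) (t, x)
        - lift A (sharp A g (\<lambda>Y y. g y (nablaR Y \<delta> y) (V y))) (t, x)"
proof -
  \<comment> \<open>-K is twice the product of the derivative with the slice normal: V(\<beta>)
    stems from the time field and the two remaining terms from the lift of \<delta>.\<close>
  define K where "K = V x \<beta> + g x (\<delta> x) (nablaR V \<delta> x) - g x (nablaR \<delta> \<delta> x) (V x)"
  define s where "s = sharp A g (\<lambda>Y y. g y (nablaR Y \<delta> y) (V y))"
  \<comment> \<open>The factor 1/2 is there because \<open>G_cancel\<close> determines the
    derivative itself, while the formula is stated for its double.\<close>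
  define v where "v = (1/2) *\<^sub>T ((\<Lambda> * K) *\<^sub>T \<delta> x + nablaR V \<delta> x - s x)"
  have s: "s x \<in> tangent_space A x" unfolding s_def by (rule tangent_sharp[OF V])
  have gs: "g x (s x) (Y x) = g x (nablaR Y \<delta> x) (V x)" if "Y \<in> vector_fields A" for Y
    unfolding s_def by (rule metric_sharp[OF V that])
  note tan = tangent_\<delta> tangent_nablaR[OF V \<delta>] s
  have eq: "nabla (lift A V) (time_field A) (t, x) = tvec_pair A (t, x) (- 1/2 * \<Lambda> * K) v"
  proof (rule G_cancel[OF tangent_nabla[OF V[THEN lift_vector_field] time_field_vector_field]])
    show "v \<in> tangent_space A x"
      by (simp add: v_def tan tangent_space_add tangent_space_diff tangent_space_scale)
    have "g x (\<delta> x) v = 1/2 * (\<Lambda> * K * g x (\<delta> x) (\<delta> x) + g x (\<delta> x) (nablaR V \<delta> x) - g x (nablaR \<delta> \<delta> x) (V x))"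
      using gs[OF \<delta>] by (simp add: v_def tan metric_simps metric_sym[of "\<delta> x" x "s x"])
    then have "- \<beta> x * (- 1/2 * \<Lambda> * K) + g x (\<delta> x) v
        = 1/2 * (K * (\<Lambda> * (\<beta> x + g x (\<delta> x) (\<delta> x))) + g x (\<delta> x) (nablaR V \<delta> x) - g x (nablaR \<delta> \<delta> x) (V x))"
      by (simp add: algebra_simps)
    then show "G (t, x) (nabla (lift A V) (time_field A) (t, x)) (time_field A (t, x))
        = - \<beta> x * (- 1/2 * \<Lambda> * K) + g x (\<delta> x) v"
      using lift_time_components(1)[OF V, of "(t, x)"] by (simp add: \<Lambda>_eq[OF assms(1)] K_def)
    fix Y assume Y: "Y \<in> vector_fields A"
    show "G (t, x) (nabla (lift A V) (time_field A) (t, x)) (lift A Y (t, x))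
        = g x v (Y x) + - 1/2 * \<Lambda> * K * g x (\<delta> x) (Y x)"
      using lift_time_components(2)[OF V Y, of "(t, x)"] vector_field_in_tangent_space[OF Y, of x]
      by (simp add: v_def tan metric_simps gs[OF Y] algebra_simps)
  qed
  show ?thesis
    unfolding eq K_def[symmetric] s_def[symmetric]
    by (auto simp: v_def time_field_def lift_def tvec_pair_def tscale_def fun_eq_iff algebra_simps)
qed

end

theorem theorem1:
  fixes A :: "('a::{t2_space, second_countable_topology}, 'e::euclidean_space) atlas"
    and gR :: "'a metric"
    and \<beta> \<Lambda> :: "'a \<Rightarrow> real"
    and \<delta> V W :: "'a vfield"
    and nablaR :: "'a vfield \<Rightarrow> 'a vfield \<Rightarrow> 'a vfield"
    and nabla :: "(real \<times> 'a) vfield \<Rightarrow> (real \<times> 'a) vfield \<Rightarrow> (real \<times> 'a) vfield"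
  assumes "smooth_atlas A"
    and "riemannian_metric A gR"
    and "smooth_fun A \<beta>" and "\<And>x. \<beta> x > 0"
    and "\<delta> \<in> vector_fields A"
    and "levi_civita A gR nablaR"
    and "levi_civita (spacetime_atlas A) (stationary_metric gR \<beta> \<delta>) nabla"
    and "V \<in> vector_fields A" and "W \<in> vector_fields A"
    and "\<And>x. \<Lambda> x = - 1 / (\<beta> x + gR x (\<delta> x) (\<delta> x))"
  shows
    "(\<forall>t x. nabla (time_field A) (time_field A) (t, x) =
        (- 1/2 * \<Lambda> x * gR x (\<delta> x) (gradient A gR \<beta> x)) *\<^sub>T time_field A (t, x)
        + (1/2 * \<Lambda> x * gR x (\<delta> x) (gradient A gR \<beta> x)) *\<^sub>T lift A \<delta> (t, x)
        + (1/2) *\<^sub>T lift A (gradient A gR \<beta>) (t, x))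
   \<and> (\<forall>t x. nabla (lift A V) (lift A W) (t, x) =
        (1/2 * \<Lambda> x * (gR x (W x) (nablaR V \<delta> x) + gR x (V x) (nablaR W \<delta> x)))
          *\<^sub>T time_field A (t, x)
        - (1/2 * \<Lambda> x * (gR x (W x) (nablaR V \<delta> x) + gR x (V x) (nablaR W \<delta> x)))
          *\<^sub>T lift A \<delta> (t, x)
        + lift A (nablaR V W) (t, x))
   \<and> (\<forall>t x. 2 *\<^sub>T nabla (lift A V) (time_field A) (t, x) =
              2 *\<^sub>T nabla (time_field A) (lift A V) (t, x))
   \<and> (\<forall>t x. 2 *\<^sub>T nabla (time_field A) (lift A V) (t, x) =
        (- \<Lambda> x * (V x \<beta> + gR x (\<delta> x) (nablaR V \<delta> x) - gR x (nablaR \<delta> \<delta> x) (V x)))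
          *\<^sub>T time_field A (t, x)
        + (\<Lambda> x * (V x \<beta> + gR x (\<delta> x) (nablaR V \<delta> x) - gR x (nablaR \<delta> \<delta> x) (V x)))
          *\<^sub>T lift A \<delta> (t, x)
        + lift A (nablaR V \<delta>) (t, x)
        - lift A (sharp A gR (\<lambda>Y y. gR y (nablaR Y \<delta> y) (V y))) (t, x))"
proof -
  interpret stationary_spacetime A gR \<beta> \<delta> nablaR nabla
    by unfold_locales (fact assms)+
  note \<Lambda> = assms(10)
  \<comment> \<open>\<open>nabla_lift_time\<close> has the arguments of \<open>nabla\<close> in the
    other order. Rewriting with the commutation makes the third conjunct reflexive and carries the
    formula over to the fourth.\<close>
  show ?thesis
    using nabla_time_time[OF \<Lambda>] nabla_lift_lift[OF \<Lambda> assms(8,9)] nabla_lift_time[OF \<Lambda> assms(8)]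
    unfolding nabla_lift_time_commute[OF assms(8)] by blast
qed

end
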